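(* For every stationary Gaussian VAR as in the context, any $0<q<1$ and any $s\in\{1,\dots,kp\}$, let $$\mathcal{C}_T=\left\{\max_{1\le i,j\le kp}|\Psi_{T,i,j}-\Gamma_{i,j}|\le\frac{(1-q)\kappa_\Gamma^2(s)}{16s}\right\}.$$ Then on $\mathcal{C}_T$: (i) $\kappa_{\Psi_T}^2(s)\ge q\,\kappa_\Gamma^2(s)$; (ii) $\phi_{\min}(\Psi_{J,J})\ge q\,\phi_{\min}(\Gamma_{J,J})$ for $J\subseteq\{1,\dots,kp\}$ with $|J|=s$. Finally, $$P(\mathcal{C}_T)\ge1-4k^2p^2\exp\left(\frac{-\zeta T}{s^2\log(T)(\log(k^2p^2)+1)}\right)-2(k^2p^2)^{1-\log(T)},\qquad \zeta=\frac{(1-q)^2\kappa_\Gamma^4(s)}{4\cdot16^3\left(\|\Gamma\|\sum_{i=0}^T\|F^i\|\right)^2}.$$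
   Context: Setting (VAR model). $T\ge1$ is the sample size; $k=k_T\ge1$ and $p=p_T\ge1$ are integers that may depend on $T$. The $\mathbb{R}^k$-valued data $y_t=(y_{t,1},\dots,y_{t,k})'$, $t=1-p,\dots,T$, satisfy $y_t=\sum_{l=1}^p\Phi_l y_{t-l}+\epsilon_t$ for $t=1,\dots,T$, where $\Phi_1,\dots,\Phi_p$ are $k\times k$ matrices (possibly depending on $T$ but not on $t$), $\epsilon_t$ are i.i.d. $N_k(0,\Sigma)$, all roots of $\det(I_k-\sum_{j=1}^p\Phi_jz^j)$ lie outside the unit disc, and $(y_t)$ is the stationary causal solution (so $y_t$ is centered Gaussian and $\epsilon_t$ is independent of $y_s$, $s<t$). $F$ is the $kp\times kp$ companion matrix of the VAR. $Z_t=(y_{t-1}',\dots,y_{t-p}')'\in\mathbb{R}^{kp}$, $X=(Z_T,\dots,Z_1)'$ ($T\times kp$), $\Psi_T=\frac1TX'X$, $\Gamma=E(\Psi_T)=E(Z_tZ_t')$; $\Psi_{J,J}$ and $\Gamma_{J,J}$ are the submatrices of $\Psi_T$ and $\Gamma$ with rows and columns indexed by $J$. $\phi_{\min}$ is the smallest eigenvalue; $\|\cdot\|$ is the Euclidean norm of a vector or the spectral norm of a matrix; $\|\cdot\|_{\ell_1}$ is the $\ell_1$ norm; $\delta_R$ is the subvector of $\delta$ indexed by $R$. For a positive semidefinite $kp\times kp$ matrix $B$ and $1\le r\le kp$, $$\kappa_B^2(r)=\min_{R\subseteq\{1,\dots,kp\},\,|R|\le r}\ \min_{\delta\in\mathbb{R}^{kp}\setminus\{0\},\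 \|\delta_{R^c}\|_{\ell_1}\le3\|\delta_R\|_{\ell_1}}\frac{\delta'B\delta}{\|\delta_R\|^2}.$$ *)

theory Defs
  imports
    "HOL-Probability.Probability"
    "Jordan_Normal_Form.Char_Poly"
    "Jordan_Normal_Form.DL_Submatrix"
begin

text \<open>
  Vectors and matrices have explicit dimensions, so that k, p and T are ordinary natural numbers.
  Indices are 0-based: the index set {1,...,n} becomes {..<n}.  \<^const>\<open>vec_index\<close> is written out,
  because HOL-Analysis uses the same infix for its own vectors.
\<close>

definition spectral_norm :: "real mat \<Rightarrow> real" where
  "spectral_norm A =
     Sup {L2_set (vec_index (A *\<^sub>v v)) {..<dim_row A} |v.
            v \<in> carrier_vec (dim_col A) \<and> L2_set (vec_index v) {..<dim_col A} = 1}"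

definition phi_min :: "real mat \<Rightarrow> real" where
  "phi_min A = Min {e. eigenvalue A e}"

text \<open>
  The double minimum over R and \<delta>, as one infimum over the admissible pairs.  It is attained: for
  each R the quotient is invariant under scaling, and the \<delta> of the cone with
  ||\<delta>_R|| = 1 form a compact set.  The cone condition and \<delta> \<noteq> 0 force \<delta>_R \<noteq> 0, so the denominator
  does not vanish and the empty R contributes nothing.
\<close>
definition kappa_sq :: "real mat \<Rightarrow> nat \<Rightarrow> real" where
  "kappa_sq B r =
     Inf {(d \<bullet> (B *\<^sub>v d)) / (L2_set (vec_index d) R)\<^sup>2 |R d.
            R \<subseteq> {..<dim_row B} \<and> card R \<le> r \<and>
            d \<in> carrier_vec (dim_row B) \<and> d \<noteq> 0\<^sub>v (dim_row B) \<and>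
            (\<Sum>i\<in>{..<dim_row B} - R. \<bar>vec_index d i\<bar>) \<le> 3 * (\<Sum>i\<in>R. \<bar>vec_index d i\<bar>)}"

definition borel_vec :: "nat \<Rightarrow> real vec measure" where
  "borel_vec n =
     vimage_algebra (carrier_vec n) (\<lambda>v. \<lambda>i\<in>{..<n}. vec_index v i) (\<Pi>\<^sub>M i\<in>{..<n}. borel)"

text \<open>
  The law N(0, v), with N(0, 0) the point mass at 0.
\<close>
definition centered_normal :: "'w measure \<Rightarrow> ('w \<Rightarrow> real) \<Rightarrow> real \<Rightarrow> bool" where
  "centered_normal M X v \<longleftrightarrow>
     X \<in> borel_measurable M \<and> 0 \<le> v \<and>
     (if v = 0 then AE \<omega> in M. X \<omega> = 0
      else distributed M lborel X (normal_density 0 (sqrt v)))"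

text \<open>
  The law N(0, S) on n-dimensional space, with S possibly singular: every linear form a'X is
  N(0, a'Sa).
\<close>
definition centered_gaussian :: "'w measure \<Rightarrow> nat \<Rightarrow> ('w \<Rightarrow> real vec) \<Rightarrow> real mat \<Rightarrow> bool" where
  "centered_gaussian M n X S \<longleftrightarrow>
     X \<in> measurable M (borel_vec n) \<and> S \<in> carrier_mat n n \<and> transpose_mat S = S \<and>
     (\<forall>a \<in> carrier_vec n. centered_normal M (\<lambda>\<omega>. a \<bullet> X \<omega>) (a \<bullet> (S *\<^sub>v a)))"

definition ar_poly_mat :: "nat \<Rightarrow> nat \<Rightarrow> (nat \<Rightarrow> real mat) \<Rightarrow> complex \<Rightarrow> complex mat" where
  "ar_poly_mat k p Phi z =
     mat k k (\<lambda>(i, j). (if i = j then 1 else 0)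
                        - (\<Sum>l = 1..p. complex_of_real (Phi l $$ (i, j)) * z ^ l))"

text \<open>
  The processes are indexed by all integers, as the notion of a stationary causal solution requires.
  Causality is the existence of an absolutely summable one-sided moving average representation
  in the innovations; stationarity is invariance of the law of the whole path under time shifts.
\<close>
locale stationary_gaussian_var = prob_space M
  for M :: "'w measure" +
  fixes k p :: nat
    and Phi :: "nat \<Rightarrow> real mat"
    and Sig :: "real mat"
    and eps y :: "int \<Rightarrow> 'w \<Rightarrow> real vec"
  assumes k_pos: "1 \<le> k"
    and p_pos: "1 \<le> p"
    and Phi_carrier: "\<And>l. l \<in> {1..p} \<Longrightarrow> Phi l \<in> carrier_mat k k"
    and stable: "\<And>z. det (ar_poly_mat k p Phi z) = 0 \<Longrightarrow> 1 < cmod z"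
    and eps_gaussian: "\<And>t. centered_gaussian M k (eps t) Sig"
    and eps_indep: "indep_vars (\<lambda>_. borel_vec k) eps UNIV"
    and y_measurable: "\<And>t. y t \<in> measurable M (borel_vec k)"
    and var_equation: "\<And>t. AE \<omega> in M. \<forall>i<k.
          vec_index (y t \<omega>) i =
            (\<Sum>l = 1..p. vec_index (Phi l *\<^sub>v y (t - int l) \<omega>) i) + vec_index (eps t \<omega>) i"
    and causal: "\<exists>A :: nat \<Rightarrow> real mat. (\<forall>j. A j \<in> carrier_mat k k) \<and>
          (\<forall>a<k. \<forall>b<k. summable (\<lambda>j. \<bar>A j $$ (a, b)\<bar>)) \<and>
          (\<forall>t. AE \<omega> in M. \<forall>i<k.
             (\<lambda>j. vec_index (A j *\<^sub>v eps (t - int j) \<omega>) i) sums vec_index (y t \<omega>) i)"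
    and stationary: "\<And>h. distr M (\<Pi>\<^sub>M t\<in>(UNIV :: int set). borel_vec k) (\<lambda>\<omega> t. y (t + h) \<omega>) =
                         distr M (\<Pi>\<^sub>M t\<in>(UNIV :: int set). borel_vec k) (\<lambda>\<omega> t. y t \<omega>)"

definition companion :: "nat \<Rightarrow> nat \<Rightarrow> (nat \<Rightarrow> real mat) \<Rightarrow> real mat" where
  "companion k p Phi =
     mat (k * p) (k * p)
       (\<lambda>(i, j). if i < k then Phi (j div k + 1) $$ (i, j mod k)
                 else if j = i - k then 1 else 0)"

text \<open>
  Z_t stacks y_(t-1), ..., y_(t-p): entry l * k + i is coordinate i of y_(t-1-l).
\<close>
definition Zvec :: "nat \<Rightarrow> nat \<Rightarrow> (int \<Rightarrow> 'w \<Rightarrow> real vec) \<Rightarrow> int \<Rightarrow> 'w \<Rightarrow> real vec" where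
  "Zvec k p y t \<omega> = vec (k * p) (\<lambda>m. vec_index (y (t - 1 - int (m div k)) \<omega>) (m mod k))"

definition Xmat :: "nat \<Rightarrow> nat \<Rightarrow> nat \<Rightarrow> (int \<Rightarrow> 'w \<Rightarrow> real vec) \<Rightarrow> 'w \<Rightarrow> real mat" where
  "Xmat k p T y \<omega> = mat T (k * p) (\<lambda>(r, j). vec_index (Zvec k p y (int T - int r) \<omega>) j)"

definition Psi :: "nat \<Rightarrow> nat \<Rightarrow> nat \<Rightarrow> (int \<Rightarrow> 'w \<Rightarrow> real vec) \<Rightarrow> 'w \<Rightarrow> real mat" where
  "Psi k p T y \<omega> = (1 / real T) \<cdot>\<^sub>m (transpose_mat (Xmat k p T y \<omega>) * Xmat k p T y \<omega>)"

definition Gam :: "'w measure \<Rightarrow> nat \<Rightarrow> nat \<Rightarrow> nat \<Rightarrow> (int \<Rightarrow> 'w \<Rightarrow> real vec) \<Rightarrow> real mat" where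
  "Gam M k p T y = mat (k * p) (k * p) (\<lambda>(i, j). \<integral>\<omega>. Psi k p T y \<omega> $$ (i, j) \<partial>M)"

definition C_event ::
  "'w measure \<Rightarrow> nat \<Rightarrow> nat \<Rightarrow> nat \<Rightarrow> (int \<Rightarrow> 'w \<Rightarrow> real vec) \<Rightarrow> real \<Rightarrow> nat \<Rightarrow> 'w set" where
  "C_event M k p T y q s =
     {\<omega> \<in> space M.
        Max {\<bar>Psi k p T y \<omega> $$ (i, j) - Gam M k p T y $$ (i, j)\<bar> |i j. i < k * p \<and> j < k * p}
          \<le> (1 - q) * kappa_sq (Gam M k p T y) s / (16 * real s)}"

definition zeta ::
  "'w measure \<Rightarrow> nat \<Rightarrow> nat \<Rightarrow> (nat \<Rightarrow> real mat) \<Rightarrow> nat \<Rightarrow> (int \<Rightarrow> 'w \<Rightarrow> real vec) \<Rightarrow> real \<Rightarrow> nat \<Rightarrow> real"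
  where
  "zeta M k p Phi T y q s =
     (1 - q)\<^sup>2 * (kappa_sq (Gam M k p T y) s)\<^sup>2 /
       (4 * 16 ^ 3 *
         (spectral_norm (Gam M k p T y) * (\<Sum>i = 0..T. spectral_norm (companion k p Phi ^\<^sub>m i)))\<^sup>2)"

end

theory Submission
  imports Defs
begin

text \<open>
  Parts (i) and (ii) are deterministic.  If every entry of \<open>\<Psi>\<close> is within
  \<open>m = (1 - q) \<kappa>\<^sup>2 / (16 s)\<close> of the entry of \<open>\<Gamma>\<close>, then \<open>|\<delta>'(\<Psi> - \<Gamma>)\<delta>| \<le> m \<parallel>\<delta>\<parallel>\<^sub>1\<^sup>2\<close>, and the cone
  condition compares the \<open>\<ell>\<^sub>1\<close> norm of \<open>\<delta>\<close> with the Euclidean norm of \<open>\<delta>\<^sub>R\<close> at the cost of the factor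
  \<open>16 s\<close>.  This gives (i) (\<open>kappa_sq_perturb\<close>).  For (ii) the same estimate is applied to an
  eigenvector of the principal submatrix of \<open>\<Psi>\<close>, extended by zeros; such a vector lies in the cone,
  so that \<open>\<kappa>\<^sup>2\<close> also controls its quadratic form in \<open>\<Gamma>\<close> (\<open>phi_min_submatrix_perturb\<close>).  The least
  eigenvalue of a real symmetric matrix is identified with the minimum of its quadratic form on the
  sphere (\<open>rayleigh_phi_min\<close>).

  The probability bound is a union bound over the entries of \<open>\<Psi> - \<Gamma>\<close>.  By polarisation each entry is,
  up to centring and scaling, a difference of sums \<open>\<Sum>\<^sub>t X\<^sub>t\<^sup>2\<close> with \<open>X\<^sub>t = u'Z\<^sub>t\<close>.  All linear
  combinations of the \<open>X\<^sub>t\<close> are Gaussian, because they are almost sure limits of linear forms in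
  independent Gaussian innovations (\<open>innovation_space_gauss\<close>), and the companion recursion yields the
  autocovariances \<open>E(Z\<^sub>s\<^sub>+\<^sub>h Z\<^sub>s') = F\<^sup>h \<Gamma>\<close> (\<open>cov_eq_power\<close>).  Hence the row sums of the covariance matrix
  \<open>S\<close> of the vector \<open>X\<close> are bounded by multiples of \<open>G = \<parallel>\<Gamma>\<parallel> \<Sum>\<^sub>i \<parallel>F\<^sup>i\<parallel>\<close>.

  It remains to bound the exponential moments of a sum of squares of jointly Gaussian variables.  An
  auxiliary standard normal vector \<open>g\<close> linearises the square, and exchanging the expectations gives
  \<open>E exp(\<theta> \<Sum>\<^sub>t X\<^sub>t\<^sup>2) = E exp(\<theta> g'Sg)\<close> (\<open>nn_integral_exp_sum_squares\<close>).  The form \<open>g'Sg\<close> consists of its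
  diagonal and of \<open>2 \<Sum>\<^sub>t g\<^sub>t \<Sum>\<^bsub>s < t\<^esub> S\<^sub>t\<^sub>s g\<^sub>s\<close>, a sum of martingale differences whose exponential is
  compensated exactly (\<open>std_normals_exp_predictable\<close>); the compensator is again a quadratic form, of
  second order in \<open>\<theta>\<close>.  This gives \<open>E exp(\<theta> (g'Sg - tr S)) \<le> exp(16 \<theta>\<^sup>2 K\<^sup>2 T)\<close> for small \<open>\<theta>\<close>, where
  \<open>K\<close> bounds the sums of \<open>|S\<^sub>t\<^sub>s|\<close> along the rows and the columns of the lower triangle, and then a tail
  bound of Hanson--Wright type (\<open>gauss_sum_squares_deviation\<close>).  The threshold of the event is at most
  \<open>\<kappa>\<^sup>2 \<le> \<parallel>\<Gamma>\<parallel> \<le> G\<close>, so only the Gaussian regime of this bound occurs, and the probability of the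
  complement of the event is at most \<open>4 (kp)\<^sup>2 exp(- \<zeta> T / s\<^sup>2)\<close> (\<open>prob_C_event_ge\<close>).  For \<open>T \<ge> 2\<close> and
  \<open>kp \<ge> 2\<close> the logarithmic factor \<open>log T (log (kp)\<^sup>2 + 1)\<close> is at least 1, which gives the claim; for
  \<open>T = 1\<close>, \<open>kp = 1\<close> or \<open>\<kappa> = 0\<close> the claimed lower bound is not positive.
\<close>

section \<open>Centred Gaussian laws\<close>

text \<open>
  Stating N(0, v) as the law of \<open>sqrt v\<close> times a standard normal variable treats \<open>v = 0\<close>
  and \<open>v > 0\<close> alike, so that limits and sums of Gaussian variables need no case distinction.
\<close>

definition gauss_law :: "'w measure \<Rightarrow> ('w \<Rightarrow> real) \<Rightarrow> real \<Rightarrow> bool" where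
  "gauss_law M W v \<longleftrightarrow> W \<in> borel_measurable M \<and> 0 \<le> v \<and>
     distr M borel W = distr std_normal_distribution borel (\<lambda>x. sqrt v * x)"

abbreviation std_normals :: "nat \<Rightarrow> (nat \<Rightarrow> real) measure" where
  "std_normals n \<equiv> \<Pi>\<^sub>M i\<in>{..<n}. std_normal_distribution"

lemma char_scaled_std_normal:
  "char (distr std_normal_distribution borel (\<lambda>x. c * x)) t = complex_of_real (exp (- c\<^sup>2 * t\<^sup>2 / 2))"
proof -
  have "char (distr std_normal_distribution borel (\<lambda>x. c * x)) t = char std_normal_distribution (t * c)"
    unfolding char_def by (subst integral_distr) (auto simp: mult.assoc)
  also have "\<dots> = complex_of_real (exp (- (t * c)\<^sup>2 / 2))"
    by (simp add: char_std_normal_distribution)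
  also have "- (t * c)\<^sup>2 / 2 = - c\<^sup>2 * t\<^sup>2 / 2" by (simp add: power_mult_distrib)
  finally show ?thesis .
qed

context prob_space
begin

lemma gauss_lawI_char:
  assumes W: "W \<in> borel_measurable M" and v: "0 \<le> v"
    and ch: "\<And>t. char (distr M borel W) t = complex_of_real (exp (- v * t\<^sup>2 / 2))"
  shows "gauss_law M W v"
proof -
  interpret N: real_distribution std_normal_distribution by (rule real_dist_normal_dist)
  have 1: "real_distribution (distr M borel W)" using W by (rule real_distribution_distr)
  have 2: "real_distribution (distr std_normal_distribution borel (\<lambda>x. sqrt v * x))"
    by (rule N.real_distribution_distr) simp
  have "distr M borel W = distr std_normal_distribution borel (\<lambda>x. sqrt v * x)"
    by (rule Levy_uniqueness[OF 1 2]) (auto simp: ch char_scaled_std_normal v)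
  with W v show ?thesis by (simp add: gauss_law_def)
qed

lemma gauss_law_char:
  assumes "gauss_law M W v"
  shows "char (distr M borel W) t = complex_of_real (exp (- v * t\<^sup>2 / 2))"
  using assms by (simp add: gauss_law_def char_scaled_std_normal)

lemma gauss_law_integral:
  fixes f :: "real \<Rightarrow> 'b::{banach,second_countable_topology}"
  assumes "gauss_law M W v" and [measurable]: "f \<in> borel_measurable borel"
  shows "(\<integral>\<omega>. f (W \<omega>) \<partial>M) = (\<integral>x. f (sqrt v * x) \<partial>std_normal_distribution)"
    and "integrable M (\<lambda>\<omega>. f (W \<omega>)) \<longleftrightarrow> integrable std_normal_distribution (\<lambda>x. f (sqrt v * x))"
proof -
  have [measurable]: "W \<in> borel_measurable M" using assms by (simp add: gauss_law_def)
  have D: "distr M borel W = distr std_normal_distribution borel (\<lambda>x. sqrt v * x)"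
    using assms by (simp add: gauss_law_def)
  show "(\<integral>\<omega>. f (W \<omega>) \<partial>M) = (\<integral>x. f (sqrt v * x) \<partial>std_normal_distribution)"
    using arg_cong[OF D, of "\<lambda>N. integral\<^sup>L N f"] by (subst (asm) (1 2) integral_distr) auto
  show "integrable M (\<lambda>\<omega>. f (W \<omega>)) \<longleftrightarrow> integrable std_normal_distribution (\<lambda>x. f (sqrt v * x))"
    using arg_cong[OF D, of "\<lambda>N. integrable N f"] by (subst (asm) (1 2) integrable_distr_eq) auto
qed

lemma gauss_law_nn_integral:
  assumes "gauss_law M W v" and [measurable]: "f \<in> borel_measurable borel"
  shows "(\<integral>\<^sup>+\<omega>. f (W \<omega>) \<partial>M) = (\<integral>\<^sup>+x. f (sqrt v * x) \<partial>std_normal_distribution)"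
proof -
  have [measurable]: "W \<in> borel_measurable M" using assms by (simp add: gauss_law_def)
  have D: "distr M borel W = distr std_normal_distribution borel (\<lambda>x. sqrt v * x)"
    using assms by (simp add: gauss_law_def)
  show ?thesis
    using arg_cong[OF D, of "\<lambda>N. integral\<^sup>N N f"] by (subst (asm) (1 2) nn_integral_distr) auto
qed

lemma gauss_law_moments:
  assumes "gauss_law M W v"
  shows "integrable M (\<lambda>\<omega>. (W \<omega>)\<^sup>2)" "(\<integral>\<omega>. (W \<omega>)\<^sup>2 \<partial>M) = v"
proof -
  have v: "0 \<le> v" using assms by (simp add: gauss_law_def)
  have i2: "integrable std_normal_distribution (\<lambda>x. x\<^sup>2)"
    using integrable_std_normal_distribution_moment[of 2] by simp
  have m2: "(LINT x|std_normal_distribution. x\<^sup>2) = 1"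
    using std_normal_distribution_even_moments(1)[of 1] by simp
  have e: "(sqrt v * x)\<^sup>2 = v * x\<^sup>2" for x using v by (simp add: power_mult_distrib)
  have "integrable std_normal_distribution (\<lambda>x. (sqrt v * x)\<^sup>2)"
    unfolding e by (rule integrable_mult_right[OF i2])
  moreover have "integrable M (\<lambda>\<omega>. (W \<omega>)\<^sup>2) \<longleftrightarrow> integrable std_normal_distribution (\<lambda>x. (sqrt v * x)\<^sup>2)"
    by (rule gauss_law_integral(2)[OF assms]) simp
  ultimately show "integrable M (\<lambda>\<omega>. (W \<omega>)\<^sup>2)" by blast
  have "(\<integral>\<omega>. (W \<omega>)\<^sup>2 \<partial>M) = (LINT x|std_normal_distribution. (sqrt v * x)\<^sup>2)"
    by (rule gauss_law_integral(1)[OF assms]) simp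
  also have "\<dots> = v * (LINT x|std_normal_distribution. x\<^sup>2)" unfolding e by (rule integral_mult_right_zero)
  finally show "(\<integral>\<omega>. (W \<omega>)\<^sup>2 \<partial>M) = v" using m2 by (simp only: mult_1_right)
qed

text \<open>
  The characteristic functions \<open>exp (- v n * t\<^sup>2 / 2)\<close> converge by dominated convergence, and the
  limit is the characteristic function of the almost sure limit, which is continuous with value 1
  at 0.  This excludes that the variances escape to infinity.  The convergence of the variances transports covariance identities from finite moving averages to the stationary solution.
\<close>

lemma gauss_law_tendsto:
  assumes W: "\<And>n. gauss_law M (W n) (v n)" and X[measurable]: "X \<in> borel_measurable M"
    and lim: "AE \<omega> in M. (\<lambda>n. W n \<omega>) \<longlonglongrightarrow> X \<omega>"
  shows "\<exists>u. v \<longlonglongrightarrow> u \<and> gauss_law M X u"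
proof -
  have Wm[measurable]: "W n \<in> borel_measurable M" for n using W by (simp add: gauss_law_def)
  have v0: "0 \<le> v n" for n using W by (simp add: gauss_law_def)
  let ?\<phi> = "char (distr M borel X)"
  interpret D: real_distribution "distr M borel X" using X by (rule real_distribution_distr)
  have conv: "(\<lambda>n. complex_of_real (exp (- v n * t\<^sup>2 / 2))) \<longlonglongrightarrow> ?\<phi> t" for t
  proof -
    have e: "complex_of_real (exp (- v n * t\<^sup>2 / 2)) = (CLINT \<omega>|M. iexp (t * W n \<omega>))" for n
      using gauss_law_char[OF W, of n t] by (simp add: char_def integral_distr)
    have f: "?\<phi> t = (CLINT \<omega>|M. iexp (t * X \<omega>))" by (simp add: char_def integral_distr)
    show ?thesis unfolding e f
    proof (rule integral_dominated_convergence[where w="\<lambda>_. 1"])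
      show "AE \<omega> in M. (\<lambda>n. iexp (t * W n \<omega>)) \<longlonglongrightarrow> iexp (t * X \<omega>)"
        using lim by eventually_elim (intro tendsto_intros)
    qed auto
  qed
  have rconv: "(\<lambda>n. exp (- v n * t\<^sup>2 / 2)) \<longlonglongrightarrow> Re (?\<phi> t)" for t
    using tendsto_Re[OF conv[of t]] by simp
  \<comment> \<open>Near \<open>0\<close> the limit characteristic function does not vanish, so the variances stay bounded
    and their logarithmic formula passes to the limit.\<close>
  have "(\<lambda>t. Re (?\<phi> t)) \<midarrow>0\<rightarrow> Re (?\<phi> 0)"
    using D.isCont_char[of 0] by (intro tendsto_Re) (simp add: isCont_def)
  then have "\<forall>\<^sub>F t in at 0. 0 < Re (?\<phi> t)"
    using D.char_zero by (intro order_tendstoD(1)[where a=0]) auto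
  then obtain d where d: "d > 0" "\<And>t. t \<noteq> 0 \<Longrightarrow> dist t 0 < d \<Longrightarrow> 0 < Re (?\<phi> t)"
    unfolding eventually_at by auto
  define t where "t = d / 2"
  have t: "t > 0" "0 < Re (?\<phi> t)" using d by (auto simp: t_def)
  define u where "u = - 2 * ln (Re (?\<phi> t)) / t\<^sup>2"
  have "(\<lambda>n. - 2 * ln (exp (- v n * t\<^sup>2 / 2)) / t\<^sup>2) \<longlonglongrightarrow> u"
    unfolding u_def using t by (intro tendsto_intros rconv) auto
  moreover have "- 2 * ln (exp (- v n * t\<^sup>2 / 2)) / t\<^sup>2 = v n" for n
    using t by simp
  ultimately have vu: "v \<longlonglongrightarrow> u" by simp
  have u0: "0 \<le> u" by (rule LIMSEQ_le_const[OF vu]) (use v0 in auto)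
  have "gauss_law M X u"
  proof (rule gauss_lawI_char[OF X u0])
    fix r
    have "(\<lambda>n. complex_of_real (exp (- v n * r\<^sup>2 / 2))) \<longlonglongrightarrow> complex_of_real (exp (- u * r\<^sup>2 / 2))"
      by (intro tendsto_intros vu) auto
    with conv[of r] show "?\<phi> r = complex_of_real (exp (- u * r\<^sup>2 / 2))"
      by (rule LIMSEQ_unique)
  qed
  with vu show ?thesis by blast
qed

lemma gauss_law_indep_sum:
  assumes "finite A" and ind: "indep_vars (\<lambda>_. borel) X A" and X: "\<And>i. i \<in> A \<Longrightarrow> gauss_law M (X i) (v i)"
  shows "gauss_law M (\<lambda>\<omega>. \<Sum>i\<in>A. X i \<omega>) (\<Sum>i\<in>A. v i)"
proof (rule gauss_lawI_char)
  show "(\<lambda>\<omega>. \<Sum>i\<in>A. X i \<omega>) \<in> borel_measurable M"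
    using X by (intro borel_measurable_sum) (auto simp: gauss_law_def)
  show "0 \<le> (\<Sum>i\<in>A. v i)" using X by (intro sum_nonneg) (auto simp: gauss_law_def)
  fix t
  have "char (distr M borel (\<lambda>\<omega>. \<Sum>i\<in>A. X i \<omega>)) t = (\<Prod>i\<in>A. complex_of_real (exp (- v i * t\<^sup>2 / 2)))"
    unfolding char_distr_sum[OF ind] by (intro prod.cong refl gauss_law_char X)
  also have "\<dots> = complex_of_real (exp (\<Sum>i\<in>A. - v i * t\<^sup>2 / 2))"
    by (simp add: exp_sum[OF \<open>finite A\<close>])
  also have "(\<Sum>i\<in>A. - v i * t\<^sup>2 / 2) = - (\<Sum>i\<in>A. v i) * t\<^sup>2 / 2"
    by (simp add: sum_distrib_right sum_negf sum_divide_distrib)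
  finally show "char (distr M borel (\<lambda>\<omega>. \<Sum>i\<in>A. X i \<omega>)) t = complex_of_real (exp (- (\<Sum>i\<in>A. v i) * t\<^sup>2 / 2))" .
qed

end

section \<open>Exponential moments of quadratic forms in standard normal variables\<close>

lemma nn_integral_normal_density:
  assumes "0 < \<sigma>" shows "(\<integral>\<^sup>+x. ennreal (normal_density \<mu> \<sigma> x) \<partial>lborel) = 1"
proof -
  interpret prob_space "density lborel (\<lambda>x. ennreal (normal_density \<mu> \<sigma> x))"
    using assms by (rule prob_space_normal_density)
  show ?thesis using emeasure_space_1 by (simp add: emeasure_density)
qed

text \<open>
  Exponential tilting: the integrand times the standard normal density is the density of
  N(l, 1).
\<close>

lemma std_normal_exp_linear:
  "(\<integral>\<^sup>+x. ennreal (exp (l * x - l\<^sup>2 / 2)) \<partial>std_normal_distribution) = 1"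
proof -
  have "std_normal_density x * exp (l * x - l\<^sup>2 / 2) = normal_density l 1 x" for x
  proof -
    have "- x\<^sup>2 / 2 + (l * x - l\<^sup>2 / 2) = - (x - l)\<^sup>2 / (2 * 1\<^sup>2)"
      by (simp add: power2_eq_square field_simps)
    then show ?thesis
      by (simp add: std_normal_density_def normal_density_def exp_add[symmetric])
  qed
  then have "(\<integral>\<^sup>+x. ennreal (exp (l * x - l\<^sup>2 / 2)) \<partial>std_normal_distribution) =
      (\<integral>\<^sup>+x. ennreal (normal_density l 1 x) \<partial>lborel)"
    by (simp add: nn_integral_density ennreal_mult[symmetric])
  then show ?thesis using nn_integral_normal_density[of 1 l] by simp
qed

lemma std_normal_exp_square:
  assumes b: "b < 1/2"
  shows "(\<integral>\<^sup>+x. ennreal (exp (b * x\<^sup>2)) \<partial>std_normal_distribution) = ennreal (1 / sqrt (1 - 2 * b))"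
proof -
  define \<sigma> where "\<sigma> = 1 / sqrt (1 - 2 * b)"
  have \<sigma>: "0 < \<sigma>" "\<sigma>\<^sup>2 = 1 / (1 - 2 * b)" using b by (auto simp: \<sigma>_def power_divide)
  have "std_normal_density x * exp (b * x\<^sup>2) = \<sigma> * normal_density 0 \<sigma> x" for x
  proof -
    have "- x\<^sup>2 / 2 + b * x\<^sup>2 = - (x - 0)\<^sup>2 / (2 * \<sigma>\<^sup>2)"
      using b by (simp add: \<sigma> field_simps)
    moreover have "1 / sqrt (2 * pi) = \<sigma> * (1 / sqrt (2 * pi * \<sigma>\<^sup>2))"
      using \<sigma>(1) by (simp add: real_sqrt_mult)
    ultimately show ?thesis
      by (simp add: std_normal_density_def normal_density_def exp_add[symmetric])
  qed
  then have "(\<integral>\<^sup>+x. ennreal (exp (b * x\<^sup>2)) \<partial>std_normal_distribution) =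
      (\<integral>\<^sup>+x. ennreal \<sigma> * ennreal (normal_density 0 \<sigma> x) \<partial>lborel)"
    using \<sigma> by (simp add: nn_integral_density ennreal_mult[symmetric])
  also have "\<dots> = ennreal \<sigma>"
    using nn_integral_normal_density[OF \<sigma>(1), of 0] by (simp add: nn_integral_cmult)
  finally show ?thesis by (simp add: \<sigma>_def)
qed

lemma inverse_sqrt_le_exp:
  assumes "\<bar>b\<bar> \<le> 1/4"
  shows "1 / sqrt (1 - 2 * b) \<le> exp (b + 4 * b\<^sup>2)"
proof -
  have p: "0 < 1 - 2 * b" using assms by linarith
  have "\<bar>ln (1 + (- 2 * b)) - (- 2 * b)\<bar> \<le> 2 * (- 2 * b)\<^sup>2"
    by (rule abs_ln_one_plus_x_minus_x_bound) (use assms in auto)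
  then have "- 2 * b - 8 * b\<^sup>2 \<le> ln (1 - 2 * b)" by (simp add: power_mult_distrib)
  then have "- (ln (1 - 2 * b) / 2) \<le> b + 4 * b\<^sup>2" by linarith
  moreover have "1 / sqrt (1 - 2 * b) = exp (- (ln (1 - 2 * b) / 2))"
    using p by (simp add: exp_minus ln_sqrt[symmetric] field_simps)
  ultimately show ?thesis by simp
qed

interpretation stdn: product_prob_space "\<lambda>_::nat. std_normal_distribution" UNIV
  using real_dist_normal_dist
  by (simp add: product_prob_space_def product_prob_space_axioms_def product_sigma_finite_def
      real_distribution_def prob_space_imp_sigma_finite)

text \<open>
  The exponential martingale of a predictable linear recursion.  The coefficient of \<open>g t\<close> depends
  only on earlier coordinates, so the coordinates can be integrated out from the last to the first,
  each contributing the factor 1.  In the proof of the quadratic form bound this replaces a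
  diagonalisation of the covariance matrix.
\<close>

lemma std_normals_exp_predictable:
  fixes a :: "nat \<Rightarrow> nat \<Rightarrow> real"
  shows "(\<integral>\<^sup>+g. ennreal (exp (\<Sum>t<n. (\<Sum>s<t. a t s * g s) * g t - (\<Sum>s<t. a t s * g s)\<^sup>2 / 2)) \<partial>std_normals n) = 1"
proof (induction n)
  case 0
  show ?case by (simp add: PiM_empty)
next
  case (Suc n)
  let ?l = "\<lambda>t g. \<Sum>s<t. a t s * g s"
  let ?E = "\<lambda>n g. exp (\<Sum>t<n. ?l t g * g t - (?l t g)\<^sup>2 / 2)"
  have ext: "?E (Suc n) (g(n := x)) = ?E n g * exp (?l n g * x - (?l n g)\<^sup>2 / 2)" for g x
  proof -
    have "?l t (g(n := x)) = ?l t g" if "t \<le> n" for t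
      by (intro sum.cong) (use that in auto)
    then have "(\<Sum>t<n. ?l t (g(n := x)) * (g(n := x)) t - (?l t (g(n := x)))\<^sup>2 / 2)
        = (\<Sum>t<n. ?l t g * g t - (?l t g)\<^sup>2 / 2)" "?l n (g(n := x)) = ?l n g"
      by (auto intro!: sum.cong)
    then show ?thesis by (simp add: exp_add)
  qed
  have "(\<integral>\<^sup>+g. ennreal (?E (Suc n) g) \<partial>std_normals (Suc n))
      = (\<integral>\<^sup>+g. (\<integral>\<^sup>+x. ennreal (?E (Suc n) (g(n := x))) \<partial>std_normal_distribution) \<partial>std_normals n)"
    unfolding lessThan_Suc
    by (rule stdn.product_nn_integral_insert) (auto, measurable)
  also have "\<dots> = (\<integral>\<^sup>+g. ennreal (?E n g) \<partial>std_normals n)"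
    unfolding ext by (simp add: ennreal_mult nn_integral_cmult std_normal_exp_linear)
  also have "\<dots> = 1" by (rule Suc)
  finally show ?case .
qed

lemma std_normals_exp_squares:
  fixes b :: "nat \<Rightarrow> real"
  assumes b: "\<And>t. t < n \<Longrightarrow> \<bar>b t\<bar> \<le> 1/4"
  shows "(\<integral>\<^sup>+g. ennreal (exp (\<Sum>t<n. b t * (g t)\<^sup>2)) \<partial>std_normals n)
    \<le> ennreal (exp (\<Sum>t<n. b t + 4 * (b t)\<^sup>2))"
proof -
  have "(\<integral>\<^sup>+g. ennreal (exp (\<Sum>t<n. b t * (g t)\<^sup>2)) \<partial>std_normals n)
      = (\<integral>\<^sup>+g. (\<Prod>t<n. ennreal (exp (b t * (g t)\<^sup>2))) \<partial>std_normals n)"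
    by (simp add: exp_sum prod_ennreal)
  also have "\<dots> = (\<Prod>t<n. \<integral>\<^sup>+x. ennreal (exp (b t * x\<^sup>2)) \<partial>std_normal_distribution)"
    by (rule stdn.product_nn_integral_prod) auto
  also have "\<dots> = (\<Prod>t<n. ennreal (1 / sqrt (1 - 2 * b t)))"
    by (intro prod.cong refl std_normal_exp_square) (use b in force)
  also have "\<dots> = ennreal (\<Prod>t<n. 1 / sqrt (1 - 2 * b t))"
    by (rule prod_ennreal) (use b in force)
  also have "\<dots> \<le> ennreal (\<Prod>t<n. exp (b t + 4 * (b t)\<^sup>2))"
    by (intro ennreal_leI prod_mono conjI inverse_sqrt_le_exp b) (use b in force)+
  also have "(\<Prod>t<n. exp (b t + 4 * (b t)\<^sup>2)) = exp (\<Sum>t<n. b t + 4 * (b t)\<^sup>2)"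
    by (simp add: exp_sum)
  finally show ?thesis by simp
qed

text \<open>
  Schur test: Cauchy--Schwarz with weights \<open>\<bar>a t s\<bar>\<close> uses the row sums, exchanging the two
  summations uses the column sums.
\<close>

lemma schur_test_strict_lower:
  fixes a :: "nat \<Rightarrow> nat \<Rightarrow> real"
  assumes row: "\<And>t. t < n \<Longrightarrow> (\<Sum>s<t. \<bar>a t s\<bar>) \<le> K"
    and col: "\<And>s. s < n \<Longrightarrow> (\<Sum>t\<in>{s<..<n}. \<bar>a t s\<bar>) \<le> K"
    and K: "0 \<le> K"
  shows "(\<Sum>t<n. (\<Sum>s<t. a t s * g s)\<^sup>2) \<le> K\<^sup>2 * (\<Sum>t<n. (g t)\<^sup>2)"
proof -
  have "(\<Sum>s<t. a t s * g s)\<^sup>2 \<le> K * (\<Sum>s<t. \<bar>a t s\<bar> * (g s)\<^sup>2)" if "t < n" for t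
  proof -
    have "(\<Sum>s<t. a t s * g s)\<^sup>2 = (\<bar>\<Sum>s<t. a t s * g s\<bar>)\<^sup>2" by simp
    also have "\<dots> \<le> (\<Sum>s<t. sqrt \<bar>a t s\<bar> * (sqrt \<bar>a t s\<bar> * \<bar>g s\<bar>))\<^sup>2"
    proof (rule power_mono)
      have "\<bar>\<Sum>s<t. a t s * g s\<bar> \<le> (\<Sum>s<t. \<bar>a t s * g s\<bar>)" by (rule sum_abs)
      also have "\<dots> = (\<Sum>s<t. sqrt \<bar>a t s\<bar> * (sqrt \<bar>a t s\<bar> * \<bar>g s\<bar>))"
        by (simp add: abs_mult mult.assoc[symmetric])
      finally show "\<bar>\<Sum>s<t. a t s * g s\<bar> \<le> (\<Sum>s<t. sqrt \<bar>a t s\<bar> * (sqrt \<bar>a t s\<bar> * \<bar>g s\<bar>))" .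
    qed simp
    also have "\<dots> \<le> (\<Sum>s<t. (sqrt \<bar>a t s\<bar>)\<^sup>2) * (\<Sum>s<t. (sqrt \<bar>a t s\<bar> * \<bar>g s\<bar>)\<^sup>2)"
      by (rule Cauchy_Schwarz_ineq_sum)
    also have "\<dots> = (\<Sum>s<t. \<bar>a t s\<bar>) * (\<Sum>s<t. \<bar>a t s\<bar> * (g s)\<^sup>2)"
      by (simp add: power_mult_distrib)
    also have "\<dots> \<le> K * (\<Sum>s<t. \<bar>a t s\<bar> * (g s)\<^sup>2)"
      by (intro mult_right_mono row that sum_nonneg) auto
    finally show ?thesis .
  qed
  then have "(\<Sum>t<n. (\<Sum>s<t. a t s * g s)\<^sup>2) \<le> (\<Sum>t<n. K * (\<Sum>s<t. \<bar>a t s\<bar> * (g s)\<^sup>2))"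
    by (intro sum_mono) auto
  also have "\<dots> = K * (\<Sum>t<n. \<Sum>s<t. \<bar>a t s\<bar> * (g s)\<^sup>2)" by (rule sum_distrib_left[symmetric])
  also have "(\<Sum>t<n. \<Sum>s<t. \<bar>a t s\<bar> * (g s)\<^sup>2) = (\<Sum>s<n. \<Sum>t\<in>{s<..<n}. \<bar>a t s\<bar> * (g s)\<^sup>2)"
    unfolding sum.Sigma[OF finite_lessThan ballI[OF finite_lessThan]]
      sum.Sigma[OF finite_lessThan ballI[OF finite_greaterThanLessThan]]
    by (rule sum.reindex_bij_witness[where i="\<lambda>(s,t). (t,s)" and j="\<lambda>(t,s). (s,t)"]) auto
  also have "\<dots> = (\<Sum>s<n. (\<Sum>t\<in>{s<..<n}. \<bar>a t s\<bar>) * (g s)\<^sup>2)" by (simp add: sum_distrib_right)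
  also have "K * \<dots> \<le> K * (\<Sum>s<n. K * (g s)\<^sup>2)"
    by (intro mult_left_mono sum_mono mult_right_mono col K) auto
  finally show ?thesis by (simp add: sum_distrib_left power2_eq_square mult.assoc)
qed

lemma symmetric_form_split:
  fixes S :: "nat \<Rightarrow> nat \<Rightarrow> real"
  assumes sym: "\<And>t s. t < n \<Longrightarrow> s < n \<Longrightarrow> S t s = S s t"
  shows "(\<Sum>t<n. \<Sum>s<n. S t s * g t * g s) =
    (\<Sum>t<n. S t t * (g t)\<^sup>2) + (\<Sum>t<n. (\<Sum>s<t. 2 * S t s * g s) * g t)"
proof -
  have "(\<Sum>t<n. \<Sum>s<n. S t s * g t * g s) =
     (\<Sum>t<n. (\<Sum>s<t. S t s * g t * g s) + S t t * g t * g t + (\<Sum>s\<in>{t<..<n}. S t s * g t * g s))"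
  proof (rule sum.cong[OF refl])
    fix t assume t: "t \<in> {..<n}"
    then have "{..<n} = {..<t} \<union> ({t} \<union> {t<..<n})" by auto
    moreover have "sum f ({..<t} \<union> ({t} \<union> {t<..<n})) = sum f {..<t} + (f t + sum f {t<..<n})" for f :: "nat \<Rightarrow> real"
      by (subst sum.union_disjoint; (subst sum.union_disjoint)?) auto
    ultimately show "(\<Sum>s<n. S t s * g t * g s) =
       (\<Sum>s<t. S t s * g t * g s) + S t t * g t * g t + (\<Sum>s\<in>{t<..<n}. S t s * g t * g s)"
      by simp
  qed
  also have "\<dots> = (\<Sum>t<n. \<Sum>s<t. S t s * g t * g s) + (\<Sum>t<n. S t t * g t * g t)
      + (\<Sum>t<n. \<Sum>s\<in>{t<..<n}. S t s * g t * g s)"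
    by (simp add: sum.distrib)
  also have "(\<Sum>t<n. \<Sum>s\<in>{t<..<n}. S t s * g t * g s) = (\<Sum>s<n. \<Sum>t<s. S s t * g s * g t)"
    unfolding sum.Sigma[OF finite_lessThan ballI[OF finite_lessThan]]
      sum.Sigma[OF finite_lessThan ballI[OF finite_greaterThanLessThan]]
    by (rule sum.reindex_bij_witness[where i="\<lambda>(s,t). (t,s)" and j="\<lambda>(t,s). (s,t)"])
      (auto simp: sym mult_ac)
  also have "(\<Sum>s<n. \<Sum>t<s. S s t * g s * g t) = (\<Sum>t<n. (\<Sum>s<t. S t s * g s) * g t)"
    by (simp add: sum_distrib_left sum_distrib_right mult_ac)
  finally have "(\<Sum>t<n. \<Sum>s<n. S t s * g t * g s) = (\<Sum>t<n. (\<Sum>s<t. S t s * g s) * g t)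
      + (\<Sum>t<n. S t t * g t * g t) + (\<Sum>t<n. (\<Sum>s<t. S t s * g s) * g t)" .
  moreover have "(\<Sum>t<n. S t t * g t * g t) = (\<Sum>t<n. S t t * (g t)\<^sup>2)"
    by (simp add: power2_eq_square mult_ac)
  moreover have "(\<Sum>t<n. (\<Sum>s<t. 2 * S t s * g s) * g t) = 2 * (\<Sum>t<n. (\<Sum>s<t. S t s * g s) * g t)"
    unfolding sum_distrib_left by (intro sum.cong) (simp_all add: sum_distrib_left sum_distrib_right mult_ac)
  ultimately show ?thesis by linarith
qed

text \<open>
  The centred exponential moment of \<open>g'Sg\<close> for a standard normal vector \<open>g\<close>.  The strictly lower
  triangular part of \<open>S\<close> makes the form a predictable linear recursion, the diagonal gives a sum of
  independent squares, and the two are decoupled by the arithmetic-geometric mean inequality.  Only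
  row and column sums of \<open>\<bar>S\<bar>\<close> enter, which for a stationary sequence are sums of
  autocovariances.
\<close>

lemma std_normals_exp_quadratic_form:
  fixes S :: "nat \<Rightarrow> nat \<Rightarrow> real"
  assumes sym: "\<And>t s. t < n \<Longrightarrow> s < n \<Longrightarrow> S t s = S s t"
    and row: "\<And>t. t < n \<Longrightarrow> (\<Sum>s\<le>t. \<bar>S t s\<bar>) \<le> K"
    and col: "\<And>s. s < n \<Longrightarrow> (\<Sum>t\<in>{s..<n}. \<bar>S t s\<bar>) \<le> K"
    and \<theta>: "\<bar>\<theta>\<bar> * K \<le> 1/32" and K: "0 \<le> K"
  shows "(\<integral>\<^sup>+g. ennreal (exp (\<theta> * ((\<Sum>t<n. \<Sum>s<n. S t s * g t * g s) - (\<Sum>t<n. S t t)))) \<partial>std_normals n)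
    \<le> ennreal (exp (16 * \<theta>\<^sup>2 * K\<^sup>2 * n))"
proof -
  define l where "l t g = (\<Sum>s<t. (4 * \<theta> * S t s) * g s)" for t and g :: "nat \<Rightarrow> real"
  define b where "b t = 2 * (4 * \<theta>\<^sup>2 * K\<^sup>2 + \<theta> * S t t)" for t
  define A where "A g = (\<Sum>t<n. l t g * g t - (l t g)\<^sup>2 / 2)" for g
  define B where "B g = (\<Sum>t<n. b t * (g t)\<^sup>2)" for g :: "nat \<Rightarrow> real"
  define d where "d = (\<Sum>t<n. 2 * \<theta> * S t t)"
  \<comment> \<open>The weight in the arithmetic-geometric mean inequality below: the two integrals
    are at most \<open>1\<close> and \<open>c\<^sup>2\<close>, and \<open>c / 2 * 1 + c\<^sup>2 / (2 * c) = c\<close>.\<close>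
  define c where "c = exp (16 * \<theta>\<^sup>2 * K\<^sup>2 * n)"
  have c: "c > 0" by (simp add: c_def)
  have diag: "\<bar>S t t\<bar> \<le> K" if "t < n" for t
    using member_le_sum[of t "{..t}" "\<lambda>s. \<bar>S t s\<bar>"] row[OF that] by simp
  define \<tau> where "\<tau> = \<bar>\<theta>\<bar> * K"
  have \<tau>: "0 \<le> \<tau>" "\<tau> \<le> 1/32" using \<theta> K by (auto simp: \<tau>_def)
  have \<tau>2: "\<theta>\<^sup>2 * K\<^sup>2 = \<tau>\<^sup>2" by (simp add: \<tau>_def power_mult_distrib)
  have \<tau>3: "\<tau>\<^sup>2 \<le> \<tau> / 32" using mult_left_mono[OF \<tau>(2) \<tau>(1)] by (simp add: power2_eq_square)
  have b: "\<bar>b t\<bar> \<le> 9/4 * \<tau>" if "t < n" for t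
  proof -
    have "\<bar>\<theta> * S t t\<bar> \<le> \<tau>" unfolding \<tau>_def abs_mult by (intro mult_left_mono diag that) auto
    moreover have "b t = 8 * \<tau>\<^sup>2 + 2 * (\<theta> * S t t)" by (simp add: b_def flip: \<tau>2)
    ultimately show ?thesis using \<tau>3 zero_le_power2[of \<tau>] by linarith
  qed
  \<comment> \<open>The part of the exponent that is linear in each new coordinate, given the previous ones,
    is compensated by half its conditional variance; the Schur test pays for the compensator.\<close>
  have split: "2 * (\<theta> * ((\<Sum>t<n. \<Sum>s<n. S t s * g t * g s) - (\<Sum>t<n. S t t))) \<le> A g + (B g - d)" for g
  proof -
    have "(\<Sum>t<n. (l t g)\<^sup>2) = (4 * \<theta>)\<^sup>2 * (\<Sum>t<n. (\<Sum>s<t. S t s * g s)\<^sup>2)"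
      unfolding l_def sum_distrib_left[of "(4 * \<theta>)\<^sup>2"]
      by (intro sum.cong refl) (simp only: power_mult_distrib[symmetric] sum_distrib_left mult.assoc)
    also have "\<dots> \<le> (4 * \<theta>)\<^sup>2 * (K\<^sup>2 * (\<Sum>t<n. (g t)\<^sup>2))"
    proof (intro mult_left_mono schur_test_strict_lower K)
      fix t assume t: "t < n"
      have "(\<Sum>s<t. \<bar>S t s\<bar>) \<le> (\<Sum>s\<le>t. \<bar>S t s\<bar>)" by (intro sum_mono2) auto
      also have "\<dots> \<le> K" by (rule row[OF t])
      finally show "(\<Sum>s<t. \<bar>S t s\<bar>) \<le> K" .
      have "(\<Sum>u\<in>{t<..<n}. \<bar>S u t\<bar>) \<le> (\<Sum>u\<in>{t..<n}. \<bar>S u t\<bar>)" by (intro sum_mono2) auto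
      also have "\<dots> \<le> K" by (rule col[OF t])
      finally show "(\<Sum>u\<in>{t<..<n}. \<bar>S u t\<bar>) \<le> K" .
    qed auto
    finally have L: "(\<Sum>t<n. (l t g)\<^sup>2 / 2) \<le> (\<Sum>t<n. 8 * \<theta>\<^sup>2 * K\<^sup>2 * (g t)\<^sup>2)"
      by (simp add: sum_divide_distrib[symmetric] sum_distrib_left[symmetric] power_mult_distrib)
    have "2 * (\<theta> * ((\<Sum>t<n. \<Sum>s<n. S t s * g t * g s) - (\<Sum>t<n. S t t)))
        = 2 * \<theta> * (\<Sum>t<n. S t t * (g t)\<^sup>2) + 2 * \<theta> * (\<Sum>t<n. (\<Sum>s<t. 2 * S t s * g s) * g t)
          - 2 * \<theta> * (\<Sum>t<n. S t t)"
      by (subst symmetric_form_split[OF sym]) (simp_all add: algebra_simps)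
    also have "2 * \<theta> * (\<Sum>t<n. (\<Sum>s<t. 2 * S t s * g s) * g t) = (\<Sum>t<n. l t g * g t)"
      unfolding l_def by (simp add: sum_distrib_left sum_distrib_right mult_ac)
    also have "2 * \<theta> * (\<Sum>t<n. S t t) = d"
      unfolding d_def by (simp add: sum_distrib_left)
    also have "2 * \<theta> * (\<Sum>t<n. S t t * (g t)\<^sup>2) = B g - (\<Sum>t<n. 8 * \<theta>\<^sup>2 * K\<^sup>2 * (g t)\<^sup>2)"
      unfolding B_def b_def by (simp add: sum_distrib_left sum_subtractf[symmetric] algebra_simps)
    also have "(\<Sum>t<n. l t g * g t) = A g + (\<Sum>t<n. (l t g)\<^sup>2 / 2)"
      unfolding A_def by (simp add: sum_subtractf)
    finally show ?thesis using L by linarith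
  qed
  have am_gm: "exp (x / 2) \<le> (c / 2) * exp y + (1 / (2 * c)) * exp z" if "x \<le> y + z" for x y z
  proof -
    have "exp (x / 2) \<le> exp (y / 2) * exp (z / 2)"
      using that by (simp add: exp_add[symmetric] add_divide_distrib[symmetric])
    also have "\<dots> \<le> (c / 2) * (exp (y / 2))\<^sup>2 + (1 / (2 * c)) * (exp (z / 2))\<^sup>2"
      using zero_le_power2[of "c * exp (y / 2) - exp (z / 2)"] c
      by (simp add: field_simps power2_eq_square)
    finally show ?thesis by (simp add: power2_eq_square exp_add[symmetric])
  qed
  have IA: "(\<integral>\<^sup>+g. ennreal (exp (A g)) \<partial>std_normals n) = 1"
    unfolding A_def l_def by (rule std_normals_exp_predictable)
  have IB: "(\<integral>\<^sup>+g. ennreal (exp (B g - d)) \<partial>std_normals n) \<le> ennreal (c\<^sup>2)"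
  proof -
    have "(\<integral>\<^sup>+g. ennreal (exp (B g - d)) \<partial>std_normals n) = (\<integral>\<^sup>+g. ennreal (exp (B g)) * ennreal (exp (- d)) \<partial>std_normals n)"
      by (simp add: ennreal_mult[symmetric] exp_add[symmetric])
    also have "\<dots> = (\<integral>\<^sup>+g. ennreal (exp (B g)) \<partial>std_normals n) * ennreal (exp (- d))"
      unfolding B_def by (rule nn_integral_multc) measurable
    also have "(\<integral>\<^sup>+g. ennreal (exp (B g)) \<partial>std_normals n) \<le> ennreal (exp (\<Sum>t<n. b t + 4 * (b t)\<^sup>2))"
      unfolding B_def by (rule std_normals_exp_squares) (use b \<tau> in force)
    also have "ennreal (exp (\<Sum>t<n. b t + 4 * (b t)\<^sup>2)) * ennreal (exp (- d))
        = ennreal (exp (\<Sum>t<n. b t + 4 * (b t)\<^sup>2 - 2 * \<theta> * S t t))"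
      by (simp add: ennreal_mult[symmetric] exp_add[symmetric] d_def sum_subtractf)
    also have "\<dots> \<le> ennreal (exp (\<Sum>t<n. 32 * \<theta>\<^sup>2 * K\<^sup>2))"
    proof (intro ennreal_leI, simp only: exp_le_cancel_iff, rule sum_mono)
      fix t assume "t \<in> {..<n}"
      then have "\<bar>b t\<bar> \<le> 9/4 * \<tau>" using b by auto
      then have "\<bar>b t\<bar>\<^sup>2 \<le> (9/4 * \<tau>)\<^sup>2" by (intro power_mono) auto
      then have "4 * (b t)\<^sup>2 \<le> 81/4 * \<tau>\<^sup>2" by (simp add: power2_eq_square)
      moreover have "b t - 2 * \<theta> * S t t = 8 * \<tau>\<^sup>2" by (simp add: b_def flip: \<tau>2)
      moreover have "32 * \<theta>\<^sup>2 * K\<^sup>2 = 32 * \<tau>\<^sup>2" by (simp flip: \<tau>2)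
      ultimately show "b t + 4 * (b t)\<^sup>2 - 2 * \<theta> * S t t \<le> 32 * \<theta>\<^sup>2 * K\<^sup>2"
        using zero_le_power2[of \<tau>] by linarith
    qed
    also have "\<dots> = ennreal (c\<^sup>2)" by (simp add: c_def power2_eq_square exp_add[symmetric])
    finally show ?thesis by (simp add: mult_right_mono)
  qed
  have "(\<integral>\<^sup>+g. ennreal (exp (\<theta> * ((\<Sum>t<n. \<Sum>s<n. S t s * g t * g s) - (\<Sum>t<n. S t t)))) \<partial>std_normals n)
      \<le> (\<integral>\<^sup>+g. ennreal (c / 2) * ennreal (exp (A g)) + ennreal (1 / (2 * c)) * ennreal (exp (B g - d)) \<partial>std_normals n)"
  proof (rule nn_integral_mono)
    fix g
    show "ennreal (exp (\<theta> * ((\<Sum>t<n. \<Sum>s<n. S t s * g t * g s) - (\<Sum>t<n. S t t))))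
      \<le> ennreal (c / 2) * ennreal (exp (A g)) + ennreal (1 / (2 * c)) * ennreal (exp (B g - d))"
      using am_gm[OF split[of g]] c by (simp add: ennreal_mult[symmetric] ennreal_plus[symmetric] del: ennreal_plus)
  qed
  also have "\<dots> = ennreal (c / 2) * (\<integral>\<^sup>+g. ennreal (exp (A g)) \<partial>std_normals n)
      + ennreal (1 / (2 * c)) * (\<integral>\<^sup>+g. ennreal (exp (B g - d)) \<partial>std_normals n)"
    unfolding A_def B_def l_def by (subst nn_integral_add) (auto simp: nn_integral_cmult)
  also have "\<dots> \<le> ennreal (c / 2) * 1 + ennreal (1 / (2 * c)) * ennreal (c\<^sup>2)"
    unfolding IA by (intro add_left_mono mult_left_mono IB) auto
  also have "\<dots> = ennreal c"
    using c by (simp add: ennreal_mult[symmetric] ennreal_plus[symmetric] power2_eq_square del: ennreal_plus)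
  finally show ?thesis by (simp add: c_def)
qed

section \<open>Sums of squares of jointly Gaussian variables\<close>

lemma std_normals_exp_linear:
  fixes c :: "nat \<Rightarrow> real"
  shows "(\<integral>\<^sup>+g. ennreal (exp (\<Sum>t<n. c t * g t)) \<partial>std_normals n) = ennreal (exp ((\<Sum>t<n. (c t)\<^sup>2) / 2))"
proof -
  have one: "(\<integral>\<^sup>+x. ennreal (exp (c t * x)) \<partial>std_normal_distribution) = ennreal (exp ((c t)\<^sup>2 / 2))" for t
  proof -
    have "ennreal (exp (c t * x)) = ennreal (exp ((c t)\<^sup>2 / 2)) * ennreal (exp (c t * x - (c t)\<^sup>2 / 2))" for x
      by (simp add: ennreal_mult[symmetric] exp_add[symmetric])
    then show ?thesis by (simp add: nn_integral_cmult std_normal_exp_linear)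
  qed
  have "(\<integral>\<^sup>+g. ennreal (exp (\<Sum>t<n. c t * g t)) \<partial>std_normals n)
      = (\<integral>\<^sup>+g. (\<Prod>t<n. ennreal (exp (c t * g t))) \<partial>std_normals n)"
    by (simp add: exp_sum prod_ennreal)
  also have "\<dots> = (\<Prod>t<n. \<integral>\<^sup>+x. ennreal (exp (c t * x)) \<partial>std_normal_distribution)"
    by (rule stdn.product_nn_integral_prod) auto
  also have "\<dots> = ennreal (exp ((\<Sum>t<n. (c t)\<^sup>2) / 2))"
    by (simp add: one prod_ennreal exp_sum[symmetric] sum_divide_distrib)
  finally show ?thesis .
qed

text \<open>
  The characteristic function analogue serves negative exponents of sums of squares, for which the
  linearisation needs an imaginary coefficient.
\<close>

lemma std_normals_iexp_linear:
  fixes c :: "nat \<Rightarrow> real"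
  shows "(\<integral>g. iexp (\<Sum>t<n. c t * g t) \<partial>std_normals n) = complex_of_real (exp (- (\<Sum>t<n. (c t)\<^sup>2) / 2))"
proof -
  have N: "prob_space std_normal_distribution"
    using real_dist_normal_dist by (simp add: real_distribution_def)
  have one: "(\<integral>x. iexp (c t * x) \<partial>std_normal_distribution) = complex_of_real (exp (- (c t)\<^sup>2 / 2))" for t
    using fun_cong[OF char_std_normal_distribution, of "c t"] by (simp add: char_def)
  have "(\<integral>g. iexp (\<Sum>t<n. c t * g t) \<partial>std_normals n) = (\<integral>g. (\<Prod>t<n. iexp (c t * g t)) \<partial>std_normals n)"
    by (simp add: exp_sum[symmetric] sum_distrib_left)
  also have "\<dots> = (\<Prod>t<n. \<integral>x. iexp (c t * x) \<partial>std_normal_distribution)"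
    by (rule stdn.product_integral_prod) (auto intro!: prob_space.integrable_iexp[OF N])
  also have "\<dots> = complex_of_real (exp (\<Sum>t<n. - (c t)\<^sup>2 / 2))"
    unfolding one by (simp add: exp_sum)
  also have "(\<Sum>t<n. - (c t)\<^sup>2 / 2) = - (\<Sum>t<n. (c t)\<^sup>2) / 2"
    by (simp add: sum_negf sum_divide_distrib)
  finally show ?thesis .
qed

context prob_space
begin

lemma gauss_law_combination_measurable:
  fixes X :: "nat \<Rightarrow> 'a \<Rightarrow> real"
  assumes X: "\<And>c. gauss_law M (\<lambda>\<omega>. \<Sum>t<n. c t * X t \<omega>) (V c)" and t: "t < n"
  shows "X t \<in> borel_measurable M"
proof -
  have "(\<Sum>u<n. (if u = t then 1 else 0) * X u \<omega>) = X t \<omega>" for \<omega>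
    using t by (simp add: if_distrib[of "\<lambda>x. x * _"] sum.delta cong: if_cong)
  then show ?thesis using X[of "\<lambda>u. if u = t then 1 else 0"] by (simp add: gauss_law_def)
qed

text \<open>
  Linearisation by an auxiliary standard normal vector \<open>g\<close>: \<open>exp (\<theta> * \<Sum> X t\<^sup>2)\<close> is the mean over \<open>g\<close>
  of the exponential of the linear form \<open>sqrt (2 * \<theta>) * \<Sum> X t * g t\<close>.  Exchanging the two integrals
  leaves, for fixed \<open>g\<close>, a linear combination of the \<open>X t\<close>, whose law is known.  Thus joint
  Gaussianity is used only through linear combinations, and the law of the vector \<open>X\<close>, which may be
  degenerate, never has to be identified.  For \<open>\<theta> < 0\<close> the linear form is imaginary and the
  exchange is Fubini for bounded complex functions.
\<close>

lemma nn_integral_exp_sum_squares: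
  fixes X :: "nat \<Rightarrow> 'a \<Rightarrow> real"
  assumes X: "\<And>c. gauss_law M (\<lambda>\<omega>. \<Sum>t<n. c t * X t \<omega>) (\<Sum>t<n. \<Sum>s<n. S t s * c t * c s)"
  shows "(\<integral>\<^sup>+\<omega>. ennreal (exp (\<theta> * (\<Sum>t<n. (X t \<omega>)\<^sup>2))) \<partial>M)
    = (\<integral>\<^sup>+g. ennreal (exp (\<theta> * (\<Sum>t<n. \<Sum>s<n. S t s * g t * g s))) \<partial>std_normals n)"
proof -
  interpret G: prob_space "std_normals n" 
    by (rule prob_space_PiM) (use real_dist_normal_dist in \<open>simp add: real_distribution_def\<close>)
  interpret P: pair_prob_space M "std_normals n" ..
  have Xm: "X t \<in> borel_measurable M" if "t < n" for t
    by (rule gauss_law_combination_measurable[where X = X, OF X that])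
  define r where "r = sqrt (2 * \<bar>\<theta>\<bar>)"
  have r2: "r\<^sup>2 = 2 * \<bar>\<theta>\<bar>" by (simp add: r_def)
  let ?Q = "\<lambda>g::nat \<Rightarrow> real. \<Sum>t<n. \<Sum>s<n. S t s * g t * g s"
  define L where "L \<omega> g = (\<Sum>t<n. (r * X t \<omega>) * g t)" for \<omega> and g :: "nat \<Rightarrow> real"
  have L': "L \<omega> g = (\<Sum>t<n. (r * g t) * X t \<omega>)" for \<omega> g
    unfolding L_def by (simp add: mult_ac)
  have Lm[measurable]: "(\<lambda>(\<omega>, g). L \<omega> g) \<in> borel_measurable (M \<Otimes>\<^sub>M std_normals n)"
    unfolding L_def case_prod_beta
    by (intro borel_measurable_sum borel_measurable_times borel_measurable_const
        measurable_compose[OF measurable_fst Xm] measurable_compose[OF measurable_snd measurable_component_singleton]) auto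
  have Lvar: "gauss_law M (\<lambda>\<omega>. L \<omega> g) (2 * \<bar>\<theta>\<bar> * ?Q g)" for g
  proof -
    have "(\<Sum>t<n. \<Sum>s<n. S t s * (r * g t) * (r * g s)) = r\<^sup>2 * ?Q g"
      by (simp add: sum_distrib_left power2_eq_square mult_ac)
    then show ?thesis using X[of "\<lambda>t. r * g t"] by (simp add: L' r2)
  qed
  have Q0: "0 \<le> \<bar>\<theta>\<bar> * ?Q g" for g
    using Lvar[of g] by (simp add: gauss_law_def)
  have sq: "(\<Sum>t<n. (r * X t \<omega>)\<^sup>2) = 2 * \<bar>\<theta>\<bar> * (\<Sum>t<n. (X t \<omega>)\<^sup>2)" for \<omega>
    by (simp add: power_mult_distrib r2 sum_distrib_left)
  show ?thesis
  proof (cases "0 \<le> \<theta>")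
    case True
    have "(\<integral>\<^sup>+\<omega>. ennreal (exp (\<theta> * (\<Sum>t<n. (X t \<omega>)\<^sup>2))) \<partial>M)
       = (\<integral>\<^sup>+\<omega>. (\<integral>\<^sup>+g. ennreal (exp (L \<omega> g)) \<partial>std_normals n) \<partial>M)"
      unfolding L_def std_normals_exp_linear sq using True by simp
    also have "\<dots> = (\<integral>\<^sup>+g. (\<integral>\<^sup>+\<omega>. ennreal (exp (L \<omega> g)) \<partial>M) \<partial>std_normals n)"
      by (rule P.Fubini'[symmetric]) measurable
    also have "\<dots> = (\<integral>\<^sup>+g. ennreal (exp (\<theta> * ?Q g)) \<partial>std_normals n)"
    proof (rule nn_integral_cong)
      fix g
      have "(\<integral>\<^sup>+\<omega>. ennreal (exp (L \<omega> g)) \<partial>M)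
          = (\<integral>\<^sup>+x. ennreal (exp (sqrt (2 * \<bar>\<theta>\<bar> * ?Q g) * x)) \<partial>std_normal_distribution)"
        by (rule gauss_law_nn_integral[OF Lvar]) measurable
      also have "\<dots> = (\<integral>\<^sup>+x. ennreal (exp (\<theta> * ?Q g)) * ennreal (exp (sqrt (2 * \<bar>\<theta>\<bar> * ?Q g) * x - (sqrt (2 * \<bar>\<theta>\<bar> * ?Q g))\<^sup>2 / 2)) \<partial>std_normal_distribution)"
        using Q0[of g] True by (simp add: ennreal_mult[symmetric] exp_add[symmetric])
      also have "\<dots> = ennreal (exp (\<theta> * ?Q g))"
        by (simp add: nn_integral_cmult std_normal_exp_linear)
      finally show "(\<integral>\<^sup>+\<omega>. ennreal (exp (L \<omega> g)) \<partial>M) = ennreal (exp (\<theta> * ?Q g))" .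
    qed
    finally show ?thesis .
  next
    case False
    have [measurable]: "(\<lambda>\<omega>. \<Sum>t<n. (X t \<omega>)\<^sup>2) \<in> borel_measurable M" using Xm by auto
    have [measurable]: "?Q \<in> borel_measurable (std_normals n)" by measurable
    have i: "integrable (M \<Otimes>\<^sub>M std_normals n) (\<lambda>(\<omega>, g). iexp (L \<omega> g))"
      by (rule P.integrable_const_bound[where B=1]) (auto simp: case_prod_beta)
    have "(\<integral>\<omega>. complex_of_real (exp (\<theta> * (\<Sum>t<n. (X t \<omega>)\<^sup>2))) \<partial>M)
       = (\<integral>\<omega>. (\<integral>g. iexp (L \<omega> g) \<partial>std_normals n) \<partial>M)"
      unfolding L_def std_normals_iexp_linear sq using False by simp
    also have "\<dots> = (\<integral>g. (\<integral>\<omega>. iexp (L \<omega> g) \<partial>M) \<partial>std_normals n)"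
      by (rule P.Fubini_integral[OF i, symmetric])
    also have "\<dots> = (\<integral>g. complex_of_real (exp (\<theta> * ?Q g)) \<partial>std_normals n)"
    proof (intro Bochner_Integration.integral_cong refl)
      fix g
      have [measurable]: "(\<lambda>\<omega>. L \<omega> g) \<in> borel_measurable M" using Lvar[of g] by (simp add: gauss_law_def)
      have "(\<integral>\<omega>. iexp (L \<omega> g) \<partial>M) = char (distr M borel (\<lambda>\<omega>. L \<omega> g)) 1"
        by (simp add: char_def integral_distr)
      also have "\<dots> = complex_of_real (exp (\<theta> * ?Q g))"
        using gauss_law_char[OF Lvar[of g], of 1] False by simp
      finally show "(\<integral>\<omega>. iexp (L \<omega> g) \<partial>M) = complex_of_real (exp (\<theta> * ?Q g))" .
    qed
    finally have eq: "(\<integral>\<omega>. exp (\<theta> * (\<Sum>t<n. (X t \<omega>)\<^sup>2)) \<partial>M) = (\<integral>g. exp (\<theta> * ?Q g) \<partial>std_normals n)"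
      unfolding integral_complex_of_real of_real_eq_iff .
    have neg: "\<theta> * x \<le> 0" if "0 \<le> \<bar>\<theta>\<bar> * x" for x
      using that False by simp
    have 1: "integrable M (\<lambda>\<omega>. exp (\<theta> * (\<Sum>t<n. (X t \<omega>)\<^sup>2)))"
      by (rule integrable_const_bound[where B=1]) (auto intro!: neg sum_nonneg mult_nonneg_nonneg)
    have 2: "integrable (std_normals n) (\<lambda>g. exp (\<theta> * ?Q g))"
      by (rule G.integrable_const_bound[where B=1]) (auto intro!: neg Q0)
    show ?thesis
      using eq by (simp add: nn_integral_eq_integral[OF 1] nn_integral_eq_integral[OF 2])
  qed
qed

text \<open>
  Chernoff bound on both sides, a Hanson--Wright inequality in which \<open>K\<close> takes the place of the
  operator norm of the covariance matrix.
\<close>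

lemma gauss_sum_squares_deviation:
  fixes X :: "nat \<Rightarrow> 'a \<Rightarrow> real"
  assumes X: "\<And>c. gauss_law M (\<lambda>\<omega>. \<Sum>t<n. c t * X t \<omega>) (\<Sum>t<n. \<Sum>s<n. S t s * c t * c s)"
    and sym: "\<And>t s. t < n \<Longrightarrow> s < n \<Longrightarrow> S t s = S s t"
    and row: "\<And>t. t < n \<Longrightarrow> (\<Sum>s\<le>t. \<bar>S t s\<bar>) \<le> K"
    and col: "\<And>s. s < n \<Longrightarrow> (\<Sum>t\<in>{s..<n}. \<bar>S t s\<bar>) \<le> K"
    and K: "0 < K" and x: "0 < x" "x \<le> K"
  shows "prob {\<omega> \<in> space M. n * x \<le> \<bar>(\<Sum>t<n. (X t \<omega>)\<^sup>2) - (\<Sum>t<n. S t t)\<bar>}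
    \<le> 2 * exp (- (n * x\<^sup>2 / (64 * K\<^sup>2)))"
proof -
  have Xm: "X t \<in> borel_measurable M" if "t < n" for t
    by (rule gauss_law_combination_measurable[where X = X, OF X that])
  define D where "D \<omega> = (\<Sum>t<n. (X t \<omega>)\<^sup>2) - (\<Sum>t<n. S t t)" for \<omega>
  have Dm[measurable]: "D \<in> borel_measurable M" unfolding D_def using Xm by auto
  \<comment> \<open>This \<open>\<theta>\<close> minimises the exponent \<open>16 * \<theta>\<^sup>2 * K\<^sup>2 * n - \<theta> * n * x\<close>, with value
    \<open>- n * x\<^sup>2 / (64 * K\<^sup>2)\<close>; \<open>x \<le> K\<close> keeps \<open>\<theta> * K\<close> below \<open>1/32\<close>.\<close>
  define \<theta> where "\<theta> = x / (32 * K\<^sup>2)"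
  have \<theta>: "0 < \<theta>" using x K by (simp add: \<theta>_def)
  have mgf: "(\<integral>\<^sup>+\<omega>. ennreal (exp (\<eta> * D \<omega>)) \<partial>M) \<le> ennreal (exp (16 * \<theta>\<^sup>2 * K\<^sup>2 * n))" if "\<bar>\<eta>\<bar> = \<theta>" for \<eta>
  proof -
    have "(\<integral>\<^sup>+\<omega>. ennreal (exp (\<eta> * D \<omega>)) \<partial>M)
        = (\<integral>\<^sup>+\<omega>. ennreal (exp (- \<eta> * (\<Sum>t<n. S t t))) * ennreal (exp (\<eta> * (\<Sum>t<n. (X t \<omega>)\<^sup>2))) \<partial>M)"
      by (simp add: D_def ennreal_mult[symmetric] exp_add[symmetric] algebra_simps)
    also have "\<dots> = ennreal (exp (- \<eta> * (\<Sum>t<n. S t t))) * (\<integral>\<^sup>+\<omega>. ennreal (exp (\<eta> * (\<Sum>t<n. (X t \<omega>)\<^sup>2))) \<partial>M)"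
      by (rule nn_integral_cmult) (use Xm in auto)
    also have "\<dots> = ennreal (exp (- \<eta> * (\<Sum>t<n. S t t)))
        * (\<integral>\<^sup>+g. ennreal (exp (\<eta> * (\<Sum>t<n. \<Sum>s<n. S t s * g t * g s))) \<partial>std_normals n)"
      by (simp only: nn_integral_exp_sum_squares[OF X])
    also have "\<dots> = (\<integral>\<^sup>+g. ennreal (exp (- \<eta> * (\<Sum>t<n. S t t)))
        * ennreal (exp (\<eta> * (\<Sum>t<n. \<Sum>s<n. S t s * g t * g s))) \<partial>std_normals n)"
      by (rule nn_integral_cmult[symmetric]) measurable
    also have "\<dots> = (\<integral>\<^sup>+g. ennreal (exp (\<eta> * ((\<Sum>t<n. \<Sum>s<n. S t s * g t * g s) - (\<Sum>t<n. S t t)))) \<partial>std_normals n)"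
      by (simp add: ennreal_mult[symmetric] exp_add[symmetric] algebra_simps)
    also have "\<dots> \<le> ennreal (exp (16 * \<eta>\<^sup>2 * K\<^sup>2 * n))"
      by (rule std_normals_exp_quadratic_form[OF sym row col])
        (use that K x in \<open>auto simp: \<theta>_def power2_eq_square\<close>)
    finally show ?thesis using that power2_abs[of \<eta>] by simp
  qed
  have tail: "emeasure M {\<omega> \<in> space M. n * x \<le> \<sigma> * D \<omega>} \<le> ennreal (exp (- (n * x\<^sup>2 / (64 * K\<^sup>2))))"
    if "\<bar>\<sigma>\<bar> = 1" for \<sigma>
  proof -
    have "emeasure M {\<omega> \<in> space M. n * x \<le> \<sigma> * D \<omega>}
       \<le> ennreal (exp (- \<theta> * (n * x))) * (\<integral>\<^sup>+\<omega>. ennreal (exp (\<theta> * (\<sigma> * D \<omega>))) * indicator (space M) \<omega> \<partial>M)"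
      by (rule Chernoff_ineq_nn_integral_ge[OF \<theta>]) auto
    also have "(\<integral>\<^sup>+\<omega>. ennreal (exp (\<theta> * (\<sigma> * D \<omega>))) * indicator (space M) \<omega> \<partial>M)
        = (\<integral>\<^sup>+\<omega>. ennreal (exp ((\<theta> * \<sigma>) * D \<omega>)) \<partial>M)"
      by (intro nn_integral_cong) (simp add: mult.assoc)
    also have "\<dots> \<le> ennreal (exp (16 * \<theta>\<^sup>2 * K\<^sup>2 * n))"
      by (rule mgf) (use that \<theta> in \<open>simp add: abs_mult\<close>)
    also have "ennreal (exp (- \<theta> * (n * x))) * ennreal (exp (16 * \<theta>\<^sup>2 * K\<^sup>2 * n))
        = ennreal (exp (- (n * x\<^sup>2 / (64 * K\<^sup>2))))"
      using K by (simp add: ennreal_mult[symmetric] exp_add[symmetric] \<theta>_def power2_eq_square field_simps)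
    finally show ?thesis by (simp add: mult_left_mono)
  qed
  have tail': "prob {\<omega> \<in> space M. n * x \<le> \<sigma> * D \<omega>} \<le> exp (- (n * x\<^sup>2 / (64 * K\<^sup>2)))"
    if "\<bar>\<sigma>\<bar> = 1" for \<sigma>
    using tail[OF that] by (simp add: emeasure_eq_measure)
  have "{\<omega> \<in> space M. n * x \<le> \<bar>D \<omega>\<bar>}
      = {\<omega> \<in> space M. n * x \<le> 1 * D \<omega>} \<union> {\<omega> \<in> space M. n * x \<le> -1 * D \<omega>}" by auto
  then have "prob {\<omega> \<in> space M. n * x \<le> \<bar>D \<omega>\<bar>}
      \<le> prob {\<omega> \<in> space M. n * x \<le> 1 * D \<omega>} + prob {\<omega> \<in> space M. n * x \<le> -1 * D \<omega>}"
    by (simp only:) (rule measure_Un_le; measurable)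
  also have "\<dots> \<le> 2 * exp (- (n * x\<^sup>2 / (64 * K\<^sup>2)))"
    using tail'[of 1] tail'[of "-1"] by simp
  finally show ?thesis by (simp only: D_def)
qed

end

section \<open>Restricted eigenvalues and least eigenvalues under perturbation\<close>

text \<open>
  Coordinates are functions on the natural numbers, of which only the values below \<open>n\<close> matter;
  test vectors can then be given by \<open>\<lambda>\<close>-terms without carrier conditions.
\<close>

definition quad :: "nat \<Rightarrow> real mat \<Rightarrow> (nat \<Rightarrow> real) \<Rightarrow> real" where
  "quad n B x = (\<Sum>i<n. \<Sum>j<n. x i * B $$ (i, j) * x j)"

definition psd :: "nat \<Rightarrow> real mat \<Rightarrow> bool" where
  "psd n B \<longleftrightarrow> B \<in> carrier_mat n n \<and> (\<forall>i<n. \<forall>j<n. B $$ (i, j) = B $$ (j, i)) \<and> (\<forall>x. 0 \<le> quad n B x)"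

lemma mult_mat_vec_index:
  assumes "A \<in> carrier_mat m n" "v \<in> carrier_vec n" "i < m"
  shows "vec_index (A *\<^sub>v v) i = (\<Sum>j<n. A $$ (i, j) * vec_index v j)"
  using assms by (simp add: scalar_prod_def row_def atLeast0LessThan)

lemma scalar_prod_eq_sum:
  "scalar_prod u v = (\<Sum>i<dim_vec v. vec_index u i * vec_index v i)"
  by (simp add: scalar_prod_def atLeast0LessThan)

lemma quad_eq:
  assumes "B \<in> carrier_mat n n" "d \<in> carrier_vec n"
  shows "scalar_prod d (B *\<^sub>v d) = quad n B (vec_index d)"
proof -
  have "scalar_prod d (B *\<^sub>v d) = (\<Sum>i<n. vec_index d i * vec_index (B *\<^sub>v d) i)"
    using assms by (simp add: scalar_prod_eq_sum)
  also have "\<dots> = (\<Sum>i<n. vec_index d i * (\<Sum>j<n. B $$ (i, j) * vec_index d j))"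
    by (intro sum.cong refl arg_cong2[where f="(*)"] mult_mat_vec_index[OF assms]) simp
  finally show ?thesis by (simp add: quad_def sum_distrib_left mult.assoc)
qed

lemma quad_diff_le:
  assumes "\<And>i j. i < n \<Longrightarrow> j < n \<Longrightarrow> \<bar>B $$ (i, j) - C $$ (i, j)\<bar> \<le> m"
  shows "\<bar>quad n B x - quad n C x\<bar> \<le> m * (\<Sum>i<n. \<bar>x i\<bar>)\<^sup>2"
proof -
  have "quad n B x - quad n C x = (\<Sum>i<n. \<Sum>j<n. x i * (B $$ (i, j) - C $$ (i, j)) * x j)"
    by (simp add: quad_def sum_subtractf[symmetric] algebra_simps)
  also have "\<bar>\<dots>\<bar> \<le> (\<Sum>i<n. \<Sum>j<n. \<bar>x i * (B $$ (i, j) - C $$ (i, j)) * x j\<bar>)"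
    by (rule order_trans[OF sum_abs], intro sum_mono sum_abs)
  also have "\<dots> \<le> (\<Sum>i<n. \<Sum>j<n. \<bar>x i\<bar> * m * \<bar>x j\<bar>)"
    by (intro sum_mono) (auto simp: abs_mult intro!: mult_right_mono mult_left_mono assms)
  also have "\<dots> = m * (\<Sum>i<n. \<bar>x i\<bar>)\<^sup>2"
    by (simp add: power2_eq_square sum_product sum_distrib_left mult_ac)
  finally show ?thesis .
qed

lemma sum_abs_power2_le:
  fixes x :: "'a \<Rightarrow> real"
  assumes "finite R"
  shows "(\<Sum>i\<in>R. \<bar>x i\<bar>)\<^sup>2 \<le> card R * (L2_set x R)\<^sup>2"
proof -
  have "(\<Sum>i\<in>R. 1 * \<bar>x i\<bar>)\<^sup>2 \<le> (\<Sum>i\<in>R. 1\<^sup>2) * (\<Sum>i\<in>R. \<bar>x i\<bar>\<^sup>2)" by (rule Cauchy_Schwarz_ineq_sum)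
  then show ?thesis by (simp add: L2_set_def sum_nonneg)
qed

definition cone_pair :: "nat \<Rightarrow> nat \<Rightarrow> nat set \<Rightarrow> real vec \<Rightarrow> bool" where
  "cone_pair n r R d \<longleftrightarrow> R \<subseteq> {..<n} \<and> card R \<le> r \<and> d \<in> carrier_vec n \<and> d \<noteq> 0\<^sub>v n \<and>
     (\<Sum>i\<in>{..<n} - R. \<bar>vec_index d i\<bar>) \<le> 3 * (\<Sum>i\<in>R. \<bar>vec_index d i\<bar>)"

lemma kappa_sq_alt:
  assumes "B \<in> carrier_mat n n"
  shows "kappa_sq B r = Inf {quad n B (vec_index d) / (L2_set (vec_index d) R)\<^sup>2 |R d. cone_pair n r R d}"
proof -
  have "dim_row B = n" using assms by simp
  then show ?thesis unfolding kappa_sq_def cone_pair_def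
    by (intro arg_cong[where f=Inf] Collect_cong ex_cong1) (use quad_eq[OF assms] in auto)
qed

text \<open>
  On the cone the coordinates in \<open>R\<close> dominate the others in the \<open>\<ell>\<^sub>1\<close> norm, so they cannot all
  vanish.
\<close>

lemma cone_pair_pos:
  assumes "cone_pair n r R d"
  shows "0 < L2_set (vec_index d) R"
proof (rule ccontr)
  assume "\<not> 0 < L2_set (vec_index d) R"
  then have "L2_set (vec_index d) R = 0" using L2_set_nonneg[of "vec_index d" R] by linarith
  moreover have R: "R \<subseteq> {..<n}" "finite R" using assms by (auto simp: cone_pair_def finite_subset)
  ultimately have z: "\<And>i. i \<in> R \<Longrightarrow> vec_index d i = 0" by (simp add: L2_set_eq_0_iff)
  then have "(\<Sum>i\<in>{..<n} - R. \<bar>vec_index d i\<bar>) \<le> 0" using assms by (simp add: cone_pair_def)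
  then have "(\<Sum>i\<in>{..<n} - R. \<bar>vec_index d i\<bar>) = 0" by (simp add: antisym sum_nonneg)
  then have "\<And>i. i \<in> {..<n} - R \<Longrightarrow> vec_index d i = 0" by (subst (asm) sum_nonneg_eq_0_iff) auto
  with z have "\<And>i. i < n \<Longrightarrow> vec_index d i = 0" by blast
  then have "d = 0\<^sub>v n" using assms by (intro eq_vecI) (auto simp: cone_pair_def)
  then show False using assms by (simp add: cone_pair_def)
qed

lemma kappa_sq_le:
  assumes B: "psd n B" and c: "cone_pair n r R d"
  shows "kappa_sq B r \<le> quad n B (vec_index d) / (L2_set (vec_index d) R)\<^sup>2"
proof -
  have "B \<in> carrier_mat n n" using B by (simp add: psd_def)
  then show ?thesis unfolding kappa_sq_alt[OF \<open>B \<in> carrier_mat n n\<close>]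
    using B c by (intro cInf_lower bdd_belowI[where m=0]) (auto simp: psd_def)
qed

lemma cone_pair_ex: "0 < n \<Longrightarrow> 0 < r \<Longrightarrow> cone_pair n r {0} (unit_vec n 0)"
  by (auto simp: cone_pair_def)

lemma kappa_sq_ge:
  assumes "B \<in> carrier_mat n n" "0 < n" "0 < r"
    and "\<And>R d. cone_pair n r R d \<Longrightarrow> c \<le> quad n B (vec_index d) / (L2_set (vec_index d) R)\<^sup>2"
  shows "c \<le> kappa_sq B r"
  unfolding kappa_sq_alt[OF assms(1)]
  using assms(4) cone_pair_ex[OF assms(2,3)] by (intro cInf_greatest) blast+

lemma kappa_sq_nonneg:
  assumes "psd n B" "0 < n" "0 < r"
  shows "0 \<le> kappa_sq B r"
  using assms by (intro kappa_sq_ge) (auto simp: psd_def)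

text \<open>
  A vector supported on \<open>J\<close> lies in the cone of \<open>R = J\<close>, hence the restricted eigenvalue bounds the
  quadratic form on all sparse vectors.
\<close>

lemma kappa_sq_le_supported:
  assumes B: "psd n B" and J: "J \<subseteq> {..<n}" "card J \<le> r" and supp: "\<And>i. i < n \<Longrightarrow> i \<notin> J \<Longrightarrow> x i = 0"
  shows "kappa_sq B r * (\<Sum>i<n. (x i)\<^sup>2) \<le> quad n B x"
proof (cases "\<forall>i<n. x i = 0")
  case True
  then show ?thesis by (simp add: quad_def)
next
  case False
  define d where "d = vec n x"
  have dx: "vec_index d i = x i" if "i < n" for i using that by (simp add: d_def)
  have c: "cone_pair n r J d"
    unfolding cone_pair_def
  proof (intro conjI J)
    show "d \<noteq> 0\<^sub>v n" using False dx by (metis index_zero_vec(1))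
    have "(\<Sum>i\<in>{..<n} - J. \<bar>vec_index d i\<bar>) = 0" using supp dx by (intro sum.neutral) auto
    then show "(\<Sum>i\<in>{..<n} - J. \<bar>vec_index d i\<bar>) \<le> 3 * (\<Sum>i\<in>J. \<bar>vec_index d i\<bar>)"
      by (simp add: sum_nonneg)
  qed (simp add: d_def)
  have "(L2_set (vec_index d) J)\<^sup>2 = (\<Sum>i\<in>J. (vec_index d i)\<^sup>2)" by (simp add: L2_set_def sum_nonneg)
  also have "\<dots> = (\<Sum>i\<in>J. (x i)\<^sup>2)" using J dx by (intro sum.cong) auto
  also have "\<dots> = (\<Sum>i<n. (x i)\<^sup>2)" using J supp by (intro sum.mono_neutral_left) auto
  finally have L: "(L2_set (vec_index d) J)\<^sup>2 = (\<Sum>i<n. (x i)\<^sup>2)" .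
  have Q: "quad n B (vec_index d) = quad n B x" unfolding quad_def by (simp add: dx)
  show ?thesis
    using kappa_sq_le[OF B c] cone_pair_pos[OF c] unfolding L Q
    by (metis L pos_le_divide_eq zero_less_power)
qed

text \<open>
  On the cone \<open>\<parallel>\<delta>\<parallel>\<^sub>1 \<le> 4 * \<parallel>\<delta>\<^sub>R\<parallel>\<^sub>1 \<le> 4 * sqrt s * \<parallel>\<delta>\<^sub>R\<parallel>\<close>, so an entrywise perturbation by \<open>m\<close>
  changes \<open>\<delta>'C\<delta>\<close> by at most \<open>16 * m * s * \<parallel>\<delta>\<^sub>R\<parallel>\<^sup>2\<close>.
\<close>

lemma kappa_sq_perturb:
  assumes B: "B \<in> carrier_mat n n" and C: "psd n C"
    and m: "\<And>i j. i < n \<Longrightarrow> j < n \<Longrightarrow> \<bar>B $$ (i, j) - C $$ (i, j)\<bar> \<le> m"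
    and n: "0 < n" "0 < s" and ms: "16 * m * real s \<le> (1 - q) * kappa_sq C s"
  shows "q * kappa_sq C s \<le> kappa_sq B s"
proof (rule kappa_sq_ge[OF B n])
  fix R d assume c: "cone_pair n s R d"
  let ?L = "L2_set (vec_index d) R" and ?x = "vec_index d"
  have L: "0 < ?L" using c by (rule cone_pair_pos)
  have m0: "0 \<le> m" using m[OF n(1) n(1)] by linarith
  have R: "R \<subseteq> {..<n}" "finite R" "card R \<le> s" using c by (auto simp: cone_pair_def finite_subset)
  have "(\<Sum>i<n. \<bar>?x i\<bar>) = (\<Sum>i\<in>{..<n} - R. \<bar>?x i\<bar>) + (\<Sum>i\<in>R. \<bar>?x i\<bar>)"
    using R by (intro sum.subset_diff) auto
  also have "\<dots> \<le> 4 * (\<Sum>i\<in>R. \<bar>?x i\<bar>)" using c by (simp add: cone_pair_def)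
  finally have "(\<Sum>i<n. \<bar>?x i\<bar>)\<^sup>2 \<le> (4 * (\<Sum>i\<in>R. \<bar>?x i\<bar>))\<^sup>2"
    by (intro power_mono) (auto simp: sum_nonneg)
  also have "\<dots> = 16 * (\<Sum>i\<in>R. \<bar>?x i\<bar>)\<^sup>2" by (simp add: power_mult_distrib)
  also have "\<dots> \<le> 16 * (real (card R) * ?L\<^sup>2)"
    using sum_abs_power2_le[OF R(2), of ?x] by simp
  also have "\<dots> \<le> 16 * (real s * ?L\<^sup>2)" using R by (simp add: mult_right_mono)
  finally have "m * (\<Sum>i<n. \<bar>?x i\<bar>)\<^sup>2 \<le> m * (16 * (real s * ?L\<^sup>2))" using m0 by (rule mult_left_mono)
  also have "\<dots> = (16 * m * real s) * ?L\<^sup>2" by simp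
  also have "\<dots> \<le> (1 - q) * kappa_sq C s * ?L\<^sup>2" using ms by (rule mult_right_mono) simp
  finally have "\<bar>quad n B ?x - quad n C ?x\<bar> \<le> (1 - q) * kappa_sq C s * ?L\<^sup>2"
    using quad_diff_le[where x="?x", of n B C m] m by force
  moreover have "kappa_sq C s * ?L\<^sup>2 \<le> quad n C ?x"
    using kappa_sq_le[OF C c] L by (simp add: pos_le_divide_eq)
  ultimately have "q * kappa_sq C s * ?L\<^sup>2 \<le> quad n B ?x" by (simp add: algebra_simps abs_le_iff)
  then show "q * kappa_sq C s \<le> quad n B ?x / ?L\<^sup>2" using L by (simp add: pos_le_divide_eq)
qed

text \<open>
  The sphere, embedded with zeros beyond the dimension, is a closed subset of a product of compact
  intervals.
\<close>

lemma quad_minimiser: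
  assumes n: "0 < n"
  shows "\<exists>x m. (\<Sum>i<n. (x i)\<^sup>2) = 1 \<and> quad n A x = m \<and> (\<forall>y. m * (\<Sum>i<n. (y i)\<^sup>2) \<le> quad n A y)"
proof -
  define S :: "(nat \<Rightarrow> real) set" where "S = (\<Pi>\<^sub>E i\<in>UNIV. if i < n then {-1..1} else {0}) \<inter> {x. (\<Sum>i<n. (x i)\<^sup>2) = 1}"
  have "compactin (product_topology (\<lambda>_::nat. euclidean::real topology) UNIV) (\<Pi>\<^sub>E i\<in>UNIV. if i < n then {-1..1} else {0})"
    unfolding compactin_PiE by auto
  then have cp: "compact (\<Pi>\<^sub>E i\<in>(UNIV::nat set). if i < n then {-1..1::real} else {0})"
    by (simp add: euclidean_product_topology)
  have "closed {x::nat \<Rightarrow> real. (\<Sum>i<n. (x i)\<^sup>2) = 1}"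
    by (intro closed_Collect_eq continuous_intros continuous_on_product_coordinates)
  with cp have "compact S" unfolding S_def by (rule compact_Int_closed)
  moreover have "(\<lambda>i. if i = 0 then 1 else 0) \<in> S"
    unfolding S_def using n by (auto simp: if_distrib[of "\<lambda>x. x\<^sup>2"] cong: if_cong)
  moreover have "continuous_on S (quad n A)"
    unfolding quad_def by (intro continuous_intros continuous_on_subset[OF continuous_on_product_coordinates]) auto
  ultimately obtain x where x: "x \<in> S" "\<And>y. y \<in> S \<Longrightarrow> quad n A x \<le> quad n A y"
    using continuous_attains_inf[of S "quad n A"] by blast
  have "quad n A x * (\<Sum>i<n. (y i)\<^sup>2) \<le> quad n A y" for y
  proof (cases "(\<Sum>i<n. (y i)\<^sup>2) = 0")
    case True
    then have "\<forall>i\<in>{..<n}. (y i)\<^sup>2 = 0" by (subst (asm) sum_nonneg_eq_0_iff) auto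
    then have "\<And>i. i < n \<Longrightarrow> y i = 0" by auto
    then show ?thesis using True by (simp add: quad_def)
  next
    case False
    define r where "r = sqrt (\<Sum>i<n. (y i)\<^sup>2)"
    have r: "0 < r" "r\<^sup>2 = (\<Sum>i<n. (y i)\<^sup>2)" using False sum_nonneg[of "{..<n}" "\<lambda>i. (y i)\<^sup>2"] by (auto simp: r_def less_le)
    define z where "z i = (if i < n then y i / r else 0)" for i
    have zz: "(\<Sum>i<n. (z i)\<^sup>2) = 1" using r False
      by (simp add: z_def power_divide sum_divide_distrib[symmetric])
    have "z \<in> S"
    proof -
      have "\<bar>z i\<bar> \<le> 1" if "i < n" for i
      proof -
        have "(z i)\<^sup>2 \<le> (\<Sum>i<n. (z i)\<^sup>2)" by (rule member_le_sum) (use that in auto)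
        then show ?thesis using zz by (simp add: abs_square_le_1)
      qed
      then have "z i \<in> (if i < n then {-1..1} else {0})" for i
        by (cases "i < n") (force simp: abs_le_iff, simp add: z_def)
      then show ?thesis using zz by (auto simp: S_def)
    qed
    then have "quad n A x \<le> quad n A z" by (rule x)
    also have "quad n A z = quad n A y / r\<^sup>2"
      by (simp add: quad_def z_def sum_divide_distrib power2_eq_square)
    finally have "quad n A x * r\<^sup>2 \<le> quad n A y" using r(1) by (subst (asm) pos_le_divide_eq) auto
    then show ?thesis unfolding r(2) .
  qed
  with x(1) show ?thesis by (auto simp: S_def)
qed

lemma linear_coefficient_zero:
  fixes a b :: real
  assumes "\<And>t. 0 \<le> t * a + t\<^sup>2 * b"
  shows "a = 0"
proof (rule ccontr)
  assume a: "a \<noteq> 0"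
  define c where "c = \<bar>b\<bar> + 1"
  have c: "0 < c" "b < c" by (auto simp: c_def)
  have "0 \<le> (- a / c) * a + (- a / c)\<^sup>2 * b" by (rule assms)
  also have "\<dots> = (a\<^sup>2 / c) * (b / c - 1)" using c by (simp add: power2_eq_square field_simps)
  also have "\<dots> < 0" using a c by (intro mult_pos_neg) (auto simp: field_simps)
  finally show False by simp
qed

lemma quad_add_scaled:
  assumes sym: "\<And>i j. i < n \<Longrightarrow> j < n \<Longrightarrow> A $$ (i, j) = A $$ (j, i)"
  shows "quad n A (\<lambda>i. x i + t * v i) = quad n A x + t * (2 * (\<Sum>i<n. v i * (\<Sum>j<n. A $$ (i, j) * x j))) + t\<^sup>2 * quad n A v"
proof -
  have "(\<Sum>i<n. \<Sum>j<n. x i * A $$ (i, j) * v j) = (\<Sum>i<n. \<Sum>j<n. v i * A $$ (i, j) * x j)"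
    by (subst sum.swap) (intro sum.cong refl, simp add: sym mult_ac)
  moreover have "quad n A (\<lambda>i. x i + t * v i) = quad n A x + t * (\<Sum>i<n. \<Sum>j<n. x i * A $$ (i, j) * v j)
     + t * (\<Sum>i<n. \<Sum>j<n. v i * A $$ (i, j) * x j) + t\<^sup>2 * quad n A v"
    unfolding quad_def by (simp add: sum_distrib_left sum.distrib[symmetric] power2_eq_square algebra_simps)
  moreover have "(\<Sum>i<n. v i * (\<Sum>j<n. A $$ (i, j) * x j)) = (\<Sum>i<n. \<Sum>j<n. v i * A $$ (i, j) * x j)"
    by (simp add: sum_distrib_left mult.assoc)
  ultimately show ?thesis by (simp add: algebra_simps)
qed

text \<open>
  A minimiser of the quadratic form on the sphere is an eigenvector for the minimal value: along each
  coordinate direction the nonnegative quadratic polynomial \<open>quad A (x + t v) - m * \<parallel>x + t v\<parallel>\<^sup>2\<close> vanishes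
  at \<open>t = 0\<close>, so its linear coefficient is zero.  This shows at once that eigenvalues exist, so that
  the minimum defining \<open>phi_min\<close> is taken over a nonempty set, and that the least one bounds the
  form.
\<close>

lemma rayleigh_phi_min:
  assumes A: "A \<in> carrier_mat n n" and sym: "\<And>i j. i < n \<Longrightarrow> j < n \<Longrightarrow> A $$ (i, j) = A $$ (j, i)"
    and n: "0 < n"
  shows "phi_min A * (\<Sum>i<n. (x i)\<^sup>2) \<le> quad n A x" "eigenvalue A (phi_min A)"
proof -
  have fin: "finite {e. eigenvalue A e}"
  proof -
    have "char_poly A \<noteq> 0" using degree_monic_char_poly[OF A] n by auto
    then show ?thesis unfolding eigenvalue_root_char_poly[OF A] by (rule poly_roots_finite)
  qed
  obtain x0 m where x0: "(\<Sum>i<n. (x0 i)\<^sup>2) = 1" "quad n A x0 = m"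
    and min: "\<And>y. m * (\<Sum>i<n. (y i)\<^sup>2) \<le> quad n A y"
    using quad_minimiser[OF n, of A] by blast
  have crit: "(\<Sum>j<n. A $$ (i, j) * x0 j) = m * x0 i" if i: "i < n" for i
  proof -
    define v where "v j = (if j = i then 1 else 0::real)" for j
    have vs: "(\<Sum>j<n. v j * f j) = f i" for f :: "nat \<Rightarrow> real"
      using i by (simp add: v_def if_distrib[of "\<lambda>x. x * _"] cong: if_cong)
    have "0 \<le> t * (2 * ((\<Sum>j<n. A $$ (i, j) * x0 j) - m * x0 i)) + t\<^sup>2 * (quad n A v - m * (\<Sum>j<n. (v j)\<^sup>2))" for t
    proof -
      have "m * (\<Sum>j<n. (x0 j + t * v j)\<^sup>2) \<le> quad n A (\<lambda>j. x0 j + t * v j)" by (rule min)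
      also have "\<dots> = m + t * (2 * (\<Sum>j<n. A $$ (i, j) * x0 j)) + t\<^sup>2 * quad n A v"
        using quad_add_scaled[of n A x0 t v, OF sym] x0(2) vs[of "\<lambda>i. \<Sum>j<n. A $$ (i, j) * x0 j"] by simp
      also have "(\<Sum>j<n. (x0 j + t * v j)\<^sup>2) = (\<Sum>j<n. (x0 j)\<^sup>2) + 2 * t * (\<Sum>j<n. v j * x0 j) + t\<^sup>2 * (\<Sum>j<n. (v j)\<^sup>2)"
        unfolding sum_distrib_left sum.distrib[symmetric]
        by (intro sum.cong refl) (simp add: power2_eq_square algebra_simps)
      finally show ?thesis unfolding vs x0(1) by (simp add: algebra_simps)
    qed
    from linear_coefficient_zero[OF this] show ?thesis by simp
  qed
  define w where "w = vec n x0"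
  have w: "w \<in> carrier_vec n" by (simp add: w_def)
  have "A *\<^sub>v w = m \<cdot>\<^sub>v w"
  proof (rule eq_vecI)
    show "dim_vec (A *\<^sub>v w) = dim_vec (m \<cdot>\<^sub>v w)" using A by (simp add: w_def)
    fix i assume "i < dim_vec (m \<cdot>\<^sub>v w)"
    then have i: "i < n" by (simp add: w_def)
    show "vec_index (A *\<^sub>v w) i = vec_index (m \<cdot>\<^sub>v w) i"
      unfolding mult_mat_vec_index[OF A w i] using i crit[OF i] by (simp add: w_def)
  qed
  moreover have "w \<noteq> 0\<^sub>v n"
  proof
    assume "w = 0\<^sub>v n"
    then have "\<And>i. i < n \<Longrightarrow> x0 i = 0" by (metis w_def index_vec index_zero_vec(1))
    then show False using x0(1) by simp
  qed
  ultimately have ev: "eigenvalue A m" using A w by (auto simp: eigenvalue_def eigenvector_def)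
  have "phi_min A \<le> m" unfolding phi_min_def using fin ev by (intro Min_le) auto
  then have "phi_min A * (\<Sum>i<n. (x i)\<^sup>2) \<le> m * (\<Sum>i<n. (x i)\<^sup>2)"
    by (intro mult_right_mono) (auto simp: sum_nonneg)
  with min[of x] show "phi_min A * (\<Sum>i<n. (x i)\<^sup>2) \<le> quad n A x" by linarith
  show "eigenvalue A (phi_min A)"
    using Min_in[OF fin] ev unfolding phi_min_def by blast
qed

text \<open>
  Let \<open>x\<close> be an eigenvector of the principal submatrix of \<open>B\<close> for its least eigenvalue, padded with
  zeros.  Since \<open>x\<close> is \<open>s\<close>-sparse, \<open>\<kappa> * \<parallel>x\<parallel>\<^sup>2 \<le> x'Cx\<close>, so the perturbation costs at most the fraction
  \<open>1 - q\<close> of \<open>x'Cx\<close>, which is itself at least the least eigenvalue of the submatrix of \<open>C\<close> times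
  \<open>\<parallel>x\<parallel>\<^sup>2\<close>.
\<close>

lemma phi_min_submatrix_perturb:
  assumes B: "B \<in> carrier_mat n n" and Bsym: "\<And>i j. i < n \<Longrightarrow> j < n \<Longrightarrow> B $$ (i, j) = B $$ (j, i)"
    and C: "psd n C"
    and m: "\<And>i j. i < n \<Longrightarrow> j < n \<Longrightarrow> \<bar>B $$ (i, j) - C $$ (i, j)\<bar> \<le> m"
    and J: "J \<subseteq> {..<n}" "card J = s" and s: "0 < s"
    and q: "0 \<le> q" "q < 1" and ms: "16 * m * real s \<le> (1 - q) * kappa_sq C s"
  shows "q * phi_min (submatrix C J J) \<le> phi_min (submatrix B J J)"
proof -
  have C': "C \<in> carrier_mat n n" "\<And>i j. i < n \<Longrightarrow> j < n \<Longrightarrow> C $$ (i, j) = C $$ (j, i)"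
    using C by (auto simp: psd_def)
  have fJ: "finite J" using J finite_subset by blast
  have nJ: "{i. i < n \<and> i \<in> J} = J" using J by auto
  have pickJ: "pick J a \<in> J" if "a < s" for a using that J by (simp add: pick_in_set_le)
  have pickn: "pick J a < n" if "a < s" for a using pickJ[OF that] J by auto
  have inj: "inj_on (pick J) {..<s}"
    using pick_mono_le[of _ J] J(2) by (intro linorder_inj_onI) (auto simp: less_le)
  have "pick J ` {..<s} = J"
    using pickJ card_image[OF inj] J(2) by (intro card_subset_eq fJ) auto
  with inj have bij: "bij_betw (pick J) {..<s} J" by (simp add: bij_betw_def)
  have n: "0 < n" using J s by (cases n) auto
  have sub: "submatrix D J J \<in> carrier_mat s s"
    and subi: "\<And>a b. a < s \<Longrightarrow> b < s \<Longrightarrow> submatrix D J J $$ (a, b) = D $$ (pick J a, pick J b)"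
    if "D \<in> carrier_mat n n" for D :: "real mat"
    using that nJ J by (auto simp: submatrix_def)
  \<comment> \<open>Padding with zeros embeds the vectors of the principal submatrix into the supports \<open>J\<close>.\<close>
  define pad where "pad x i = (if i \<in> J then x (the_inv_into {..<s} (pick J) i) else 0)" for x :: "nat \<Rightarrow> real" and i
  have padp: "pad x (pick J a) = x a" if "a < s" for x a
    using that pickJ by (simp add: pad_def the_inv_into_f_f[OF inj])
  have pad0: "pad x i = 0" if "i \<notin> J" for x i using that by (simp add: pad_def)
  have sumJ: "(\<Sum>i<n. f i) = (\<Sum>a<s. f (pick J a))" if "\<And>i. i \<notin> J \<Longrightarrow> f i = 0" for f :: "nat \<Rightarrow> real"
  proof -
    have "(\<Sum>i<n. f i) = (\<Sum>i\<in>J. f i)" using J that by (intro sum.mono_neutral_right) auto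
    also have "\<dots> = (\<Sum>a<s. f (pick J a))" by (rule sum.reindex_bij_betw[OF bij, symmetric])
    finally show ?thesis .
  qed
  have qpad: "quad n D (pad x) = quad s (submatrix D J J) x" if D: "D \<in> carrier_mat n n" for D x
    unfolding quad_def
    by (simp add: sumJ pad0 padp subi[OF D])
  have npad: "(\<Sum>i<n. (pad x i)\<^sup>2) = (\<Sum>a<s. (x a)\<^sup>2)" for x
    by (subst sumJ) (simp_all add: pad0 padp)
  have apad: "(\<Sum>i<n. \<bar>pad x i\<bar>) = (\<Sum>a<s. \<bar>x a\<bar>)" for x
    by (subst sumJ) (simp_all add: pad0 padp)
  have "eigenvalue (submatrix B J J) (phi_min (submatrix B J J))"
    by (rule rayleigh_phi_min(2)[OF sub[OF B] _ s]) (simp add: subi[OF B] Bsym pickn)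
  then obtain w where w: "w \<in> carrier_vec s" "w \<noteq> 0\<^sub>v s"
    "submatrix B J J *\<^sub>v w = phi_min (submatrix B J J) \<cdot>\<^sub>v w"
    using sub[OF B] by (auto simp: eigenvalue_def eigenvector_def)
  let ?x = "vec_index w" and ?e = "phi_min (submatrix B J J)"
  define N where "N = (\<Sum>a<s. (?x a)\<^sup>2)"
  have N: "0 < N"
  proof -
    obtain a where "a < s" "?x a \<noteq> 0" using w(1,2) by (metis carrier_vecD eq_vecI index_zero_vec)
    then show ?thesis unfolding N_def by (intro sum_pos2[of _ a]) auto
  qed
  have "quad s (submatrix B J J) ?x = scalar_prod w (?e \<cdot>\<^sub>v w)"
    using quad_eq[OF sub[OF B] w(1)] w(3) by simp
  also have "\<dots> = ?e * N"
    using w(1) by (simp add: scalar_prod_eq_sum N_def power2_eq_square sum_distrib_left mult_ac)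
  finally have QB: "quad n B (pad ?x) = ?e * N" by (simp add: qpad[OF B])
  have m0: "0 \<le> m" using m[OF n n] by linarith
  have "(\<Sum>a<s. \<bar>?x a\<bar>)\<^sup>2 \<le> s * N"
    using sum_abs_power2_le[of "{..<s}" ?x] by (simp add: L2_set_def sum_nonneg N_def)
  then have "m * (\<Sum>a<s. \<bar>?x a\<bar>)\<^sup>2 \<le> m * (s * N)" using m0 by (rule mult_left_mono)
  also have "\<dots> \<le> 16 * m * real s * N" using m0 N by simp
  also have "\<dots> \<le> (1 - q) * kappa_sq C s * N" using ms N by (intro mult_right_mono) auto
  also have "\<dots> \<le> (1 - q) * quad n C (pad ?x)"
    using kappa_sq_le_supported[OF C J(1), of s "pad ?x"] q J(2)
    by (simp add: npad N_def mult.assoc pad0)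
  finally have "\<bar>quad n B (pad ?x) - quad n C (pad ?x)\<bar> \<le> (1 - q) * quad n C (pad ?x)"
    using quad_diff_le[where x="pad ?x", of n B C m] m by (force simp: apad)
  then have "q * quad n C (pad ?x) \<le> ?e * N" unfolding QB by (simp add: algebra_simps abs_le_iff)
  moreover have "phi_min (submatrix C J J) * N \<le> quad n C (pad ?x)"
    unfolding qpad[OF C'(1)] N_def
    by (rule rayleigh_phi_min(1)[OF sub[OF C'(1)] _ s]) (simp add: subi[OF C'(1)] C'(2) pickn)
  then have "q * (phi_min (submatrix C J J) * N) \<le> q * quad n C (pad ?x)" using q(1) by (rule mult_left_mono)
  ultimately have "(q * phi_min (submatrix C J J)) * N \<le> ?e * N" by simp
  then show ?thesis using N by simp
qed

section \<open>The spectral norm\<close>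

text \<open>
  The Frobenius bound shows that the supremum defining the spectral norm is finite.
\<close>

lemma L2_set_mult_mat_vec_le:
  assumes A: "A \<in> carrier_mat n n" and v: "v \<in> carrier_vec n"
  shows "L2_set (vec_index (A *\<^sub>v v)) {..<n} \<le> sqrt (\<Sum>i<n. \<Sum>j<n. (A $$ (i, j))\<^sup>2) * L2_set (vec_index v) {..<n}"
proof -
  have "(vec_index (A *\<^sub>v v) i)\<^sup>2 \<le> (\<Sum>j<n. (A $$ (i, j))\<^sup>2) * (\<Sum>j<n. (vec_index v j)\<^sup>2)" if "i < n" for i
    unfolding mult_mat_vec_index[OF A v that] by (rule Cauchy_Schwarz_ineq_sum)
  then have "(\<Sum>i<n. (vec_index (A *\<^sub>v v) i)\<^sup>2) \<le> (\<Sum>i<n. \<Sum>j<n. (A $$ (i, j))\<^sup>2) * (\<Sum>j<n. (vec_index v j)\<^sup>2)"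
    unfolding sum_distrib_right by (intro sum_mono) auto
  then show ?thesis unfolding L2_set_def real_sqrt_mult[symmetric] by (rule real_sqrt_le_mono)
qed

lemma bdd_above_spectral_norm:
  assumes A: "A \<in> carrier_mat n n"
  shows "bdd_above {L2_set (vec_index (A *\<^sub>v v)) {..<n} |v. v \<in> carrier_vec n \<and> L2_set (vec_index v) {..<n} = 1}"
  using L2_set_mult_mat_vec_le[OF A] by (intro bdd_aboveI) fastforce

lemma spectral_norm_eq:
  assumes "A \<in> carrier_mat n n"
  shows "spectral_norm A = Sup {L2_set (vec_index (A *\<^sub>v v)) {..<n} |v. v \<in> carrier_vec n \<and> L2_set (vec_index v) {..<n} = 1}"
  using assms by (auto simp: spectral_norm_def)

lemma spectral_norm_bound:
  assumes A: "A \<in> carrier_mat n n" and v: "v \<in> carrier_vec n"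
  shows "L2_set (vec_index (A *\<^sub>v v)) {..<n} \<le> spectral_norm A * L2_set (vec_index v) {..<n}"
proof (cases "L2_set (vec_index v) {..<n} = 0")
  case True
  then show ?thesis using L2_set_mult_mat_vec_le[OF A v] by simp
next
  case False
  define r where "r = L2_set (vec_index v) {..<n}"
  have r: "0 < r" using False L2_set_nonneg[of "vec_index v" "{..<n}"] unfolding r_def by linarith
  define w where "w = (1 / r) \<cdot>\<^sub>v v"
  have w: "w \<in> carrier_vec n" using v by (simp add: w_def)
  have "L2_set (vec_index w) {..<n} = L2_set (\<lambda>i. (1 / r) * vec_index v i) {..<n}"
    using v by (intro L2_set_cong) (auto simp: w_def)
  also have "\<dots> = (1 / r) * r" unfolding r_def by (rule L2_set_right_distrib[symmetric]) (use r r_def in simp)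
  also have "\<dots> = 1" using r by simp
  finally have w1: "L2_set (vec_index w) {..<n} = 1" .
  have "A *\<^sub>v w = (1 / r) \<cdot>\<^sub>v (A *\<^sub>v v)" unfolding w_def by (rule mult_mat_vec[OF A v])
  then have "L2_set (vec_index (A *\<^sub>v w)) {..<n} = L2_set (\<lambda>i. (1 / r) * vec_index (A *\<^sub>v v) i) {..<n}"
    using A by (intro L2_set_cong) auto
  also have "\<dots> = (1 / r) * L2_set (vec_index (A *\<^sub>v v)) {..<n}"
    using r by (simp add: L2_set_right_distrib[symmetric] del: times_divide_eq_left)
  finally have e: "L2_set (vec_index (A *\<^sub>v w)) {..<n} = (1 / r) * L2_set (vec_index (A *\<^sub>v v)) {..<n}" .
  have "(1 / r) * L2_set (vec_index (A *\<^sub>v v)) {..<n} \<le> spectral_norm A"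
    unfolding spectral_norm_eq[OF A] e[symmetric] using w w1
    by (intro cSup_upper bdd_above_spectral_norm[OF A]) blast
  then show ?thesis using r by (simp add: r_def[symmetric] field_simps)
qed

lemma L2_set_unit_vec: "0 < n \<Longrightarrow> L2_set (vec_index (unit_vec n 0 :: real vec)) {..<n} = 1"
proof -
  assume n: "0 < n"
  have "(\<Sum>i<n. (vec_index (unit_vec n 0 :: real vec) i)\<^sup>2) = (\<Sum>i<n. if i = 0 then 1 else 0)"
    by (intro sum.cong) auto
  then show ?thesis using n by (simp add: L2_set_def)
qed

lemma spectral_norm_nonneg:
  assumes A: "A \<in> carrier_mat n n" and n: "0 < n"
  shows "0 \<le> spectral_norm A"
proof -
  have "0 \<le> L2_set (vec_index (A *\<^sub>v unit_vec n 0)) {..<n}" by (rule L2_set_nonneg)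
  also have "\<dots> \<le> spectral_norm A * L2_set (vec_index (unit_vec n 0 :: real vec)) {..<n}"
    by (rule spectral_norm_bound[OF A]) simp
  finally show ?thesis unfolding L2_set_unit_vec[OF n] by simp
qed

lemma spectral_norm_one:
  assumes "0 < n" shows "spectral_norm (1\<^sub>m n :: real mat) = 1"
proof -
  have I: "(1\<^sub>m n :: real mat) *\<^sub>v v = v" if "v \<in> carrier_vec n" for v using that by simp
  have "{L2_set (vec_index ((1\<^sub>m n :: real mat) *\<^sub>v v)) {..<n} |v. v \<in> carrier_vec n \<and> L2_set (vec_index v) {..<n} = 1} = {1}"
  proof (intro equalityI subsetI)
    fix x assume "x \<in> {1::real}"
    then have "x = L2_set (vec_index ((1\<^sub>m n :: real mat) *\<^sub>v unit_vec n 0)) {..<n}"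
      using L2_set_unit_vec[OF assms] by (simp add: I)
    then show "x \<in> {L2_set (vec_index ((1\<^sub>m n :: real mat) *\<^sub>v v)) {..<n} |v. v \<in> carrier_vec n \<and> L2_set (vec_index v) {..<n} = 1}"
      using L2_set_unit_vec[OF assms] unit_vec_carrier[of n 0] by blast
  qed (use I in force)
  then show ?thesis by (simp add: spectral_norm_eq[of _ n])
qed

lemma abs_quad_mult_le:
  assumes A: "A \<in> carrier_mat n n" and B: "B \<in> carrier_mat n n" and n: "0 < n"
  shows "\<bar>quad n (A * B) u\<bar> \<le> spectral_norm A * spectral_norm B * (\<Sum>i<n. (u i)\<^sup>2)"
proof -
  define v where "v = vec n u"
  have v: "v \<in> carrier_vec n" by (simp add: v_def)
  have Bv: "B *\<^sub>v v \<in> carrier_vec n" using B v by simp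
  let ?N = "\<lambda>w. L2_set (vec_index w) {..<n}"
  have "quad n (A * B) u = quad n (A * B) (vec_index v)" by (simp add: quad_def v_def)
  also have "\<dots> = scalar_prod v (A *\<^sub>v (B *\<^sub>v v))"
    using quad_eq[of "A * B" n v] A B v by simp
  also have "\<bar>\<dots>\<bar> \<le> (\<Sum>i<n. \<bar>vec_index v i\<bar> * \<bar>vec_index (A *\<^sub>v (B *\<^sub>v v)) i\<bar>)"
    using A by (simp add: scalar_prod_eq_sum abs_mult[symmetric] sum_abs del: index_mult_mat_vec)
  also have "\<dots> \<le> ?N v * ?N (A *\<^sub>v (B *\<^sub>v v))" by (rule L2_set_mult_ineq)
  also have "?N (A *\<^sub>v (B *\<^sub>v v)) \<le> spectral_norm A * ?N (B *\<^sub>v v)" by (rule spectral_norm_bound[OF A Bv])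
  also have "?N (B *\<^sub>v v) \<le> spectral_norm B * ?N v" by (rule spectral_norm_bound[OF B v])
  finally have "\<bar>quad n (A * B) u\<bar> \<le> ?N v * (spectral_norm A * (spectral_norm B * ?N v))"
    by (simp add: mult_left_mono spectral_norm_nonneg[OF A n] L2_set_nonneg)
  also have "\<dots> = spectral_norm A * spectral_norm B * (?N v)\<^sup>2" by (simp add: power2_eq_square)
  also have "(?N v)\<^sup>2 = (\<Sum>i<n. (u i)\<^sup>2)" by (simp add: L2_set_def sum_nonneg v_def)
  finally show ?thesis .
qed

section \<open>The Gaussian space of the innovations\<close>

lemma space_borel_vec: "space (borel_vec n) = carrier_vec n"
  by (simp add: borel_vec_def)

lemma measurable_vec_index:
  assumes "i < n"
  shows "(\<lambda>v. vec_index v i) \<in> borel_measurable (borel_vec n)"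
proof -
  have "(\<lambda>v. \<lambda>i\<in>{..<n}. vec_index v i) \<in> measurable (borel_vec n) (\<Pi>\<^sub>M i\<in>{..<n}. borel)"
    unfolding borel_vec_def by (rule measurable_vimage_algebra1) (auto simp: space_PiM)
  then have "(\<lambda>v. (\<lambda>i\<in>{..<n}. vec_index v i) i) \<in> borel_measurable (borel_vec n)"
    by (rule measurable_compose[OF _ measurable_component_singleton]) (use assms in simp)
  then show ?thesis using assms by simp
qed

context prob_space
begin

lemma gauss_law_AE_cong:
  assumes X: "gauss_law M X v" and Y: "Y \<in> borel_measurable M" and eq: "AE \<omega> in M. X \<omega> = Y \<omega>"
  shows "gauss_law M Y v"
proof -
  have "distr M borel Y = distr M borel X"
    using X Y eq by (intro distr_cong_AE) (auto simp: gauss_law_def)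
  then show ?thesis using X Y by (simp add: gauss_law_def)
qed

lemma centered_normal_gauss_law:
  assumes "centered_normal M X v"
  shows "gauss_law M X v"
proof (cases "v = 0")
  case True
  have X[measurable]: "X \<in> borel_measurable M" and AE: "AE \<omega> in M. 0 = X \<omega>"
    using assms True by (auto simp: centered_normal_def)
  have "distr M borel (\<lambda>_. 0::real) = distr std_normal_distribution borel (\<lambda>x. sqrt v * x)"
  proof -
    have "emeasure std_normal_distribution UNIV = 1"
      using prob_space.emeasure_space_1[OF real_distribution.axioms(1)[OF real_dist_normal_dist]] by simp
    then show ?thesis
      using True emeasure_space_1 by (intro measure_eqI) (auto simp: emeasure_distr)
  qed
  then have "gauss_law M (\<lambda>_. 0) v" using True by (simp add: gauss_law_def)
  then show ?thesis by (rule gauss_law_AE_cong[OF _ X AE])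
next
  case False
  have X[measurable]: "X \<in> borel_measurable M" and v: "0 < v"
    and D: "distributed M lborel X (normal_density 0 (sqrt v))"
    using assms False by (auto simp: centered_normal_def)
  have D': "distributed M lborel (\<lambda>\<omega>. X \<omega> / sqrt v) std_normal_density"
    using D v by (subst (asm) normal_standard_normal_convert) auto
  have "distr M borel X = distr (distr M lborel (\<lambda>\<omega>. X \<omega> / sqrt v)) borel (\<lambda>x. sqrt v * x)"
    using v by (subst distr_distr) (auto simp: comp_def)
  also have "distr M lborel (\<lambda>\<omega>. X \<omega> / sqrt v) = std_normal_distribution"
    by (rule distributed_distr_eq_density[OF D'])
  finally show ?thesis using X v by (simp add: gauss_law_def)
qed

text \<open>
  Polarisation turns statements on variances of sums into statements on covariances.
\<close>

lemma gauss_law_product: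
  assumes W: "gauss_law M W v" and V: "gauss_law M V w" and S: "gauss_law M (\<lambda>\<omega>. W \<omega> + V \<omega>) u"
  shows "integrable M (\<lambda>\<omega>. W \<omega> * V \<omega>)" "(\<integral>\<omega>. W \<omega> * V \<omega> \<partial>M) = (u - v - w) / 2"
proof -
  have e: "(\<lambda>\<omega>. W \<omega> * V \<omega>) = (\<lambda>\<omega>. ((W \<omega> + V \<omega>)\<^sup>2 - (W \<omega>)\<^sup>2 - (V \<omega>)\<^sup>2) / 2)"
    by (auto simp: power2_eq_square algebra_simps)
  note i = gauss_law_moments(1)[OF W] gauss_law_moments(1)[OF V] gauss_law_moments(1)[OF S]
  show "integrable M (\<lambda>\<omega>. W \<omega> * V \<omega>)" unfolding e using i by auto
  show "(\<integral>\<omega>. W \<omega> * V \<omega> \<partial>M) = (u - v - w) / 2"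
    unfolding e using i gauss_law_moments(2)[OF W] gauss_law_moments(2)[OF V] gauss_law_moments(2)[OF S] by simp
qed

end

context stationary_gaussian_var
begin

definition innovation_form :: "(int \<Rightarrow> nat \<Rightarrow> real) \<Rightarrow> int set \<Rightarrow> 'w \<Rightarrow> real" where
  "innovation_form d J \<omega> = (\<Sum>r\<in>J. \<Sum>b<k. d r b * vec_index (eps r \<omega>) b)"

text \<open>
  The Gaussian space generated by the innovations at the times in \<open>A\<close>: almost sure limits of linear
  forms in finitely many of them.  Causality places \<open>y t\<close> into the space of the past
  \<open>{..t}\<close>, and spaces over disjoint sets of times are orthogonal.
\<close>

definition innovation_space :: "int set \<Rightarrow> ('w \<Rightarrow> real) set" where
  "innovation_space A = {W. W \<in> borel_measurable M \<and> (\<exists>d J. (\<forall>n::nat. finite (J n) \<and> J n \<subseteq> A) \<and>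
     (AE \<omega> in M. (\<lambda>n. innovation_form (d n) (J n) \<omega>) \<longlonglongrightarrow> W \<omega>))}"

lemma eps_measurable[measurable]: "eps t \<in> measurable M (borel_vec k)"
  using eps_gaussian by (simp add: centered_gaussian_def)

lemma innovation_form_gauss:
  assumes "finite J"
  shows "gauss_law M (innovation_form d J) (\<Sum>r\<in>J. quad k Sig (d r))"
proof -
  have lin: "(\<lambda>v. \<Sum>b<k. d r b * vec_index v b) \<in> borel_measurable (borel_vec k)" for r
    by (intro borel_measurable_sum borel_measurable_times borel_measurable_const measurable_vec_index) auto
  have ind: "indep_vars (\<lambda>_. borel) (\<lambda>r \<omega>. \<Sum>b<k. d r b * vec_index (eps r \<omega>) b) J"
    using indep_vars_compose2[OF eps_indep lin] by (rule indep_vars_subset) simp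
  have one: "gauss_law M (\<lambda>\<omega>. \<Sum>b<k. d r b * vec_index (eps r \<omega>) b) (quad k Sig (d r))" for r
  proof -
    let ?a = "vec k (d r)"
    have S: "Sig \<in> carrier_mat k k" and "centered_normal M (\<lambda>\<omega>. scalar_prod ?a (eps r \<omega>)) (scalar_prod ?a (Sig *\<^sub>v ?a))"
      using eps_gaussian[of r] by (auto simp: centered_gaussian_def)
    then have "gauss_law M (\<lambda>\<omega>. scalar_prod ?a (eps r \<omega>)) (scalar_prod ?a (Sig *\<^sub>v ?a))"
      by (intro centered_normal_gauss_law)
    moreover have "scalar_prod ?a (Sig *\<^sub>v ?a) = quad k Sig (d r)"
      unfolding quad_eq[OF S vec_carrier] by (simp add: quad_def)
    ultimately have g: "gauss_law M (\<lambda>\<omega>. scalar_prod ?a (eps r \<omega>)) (quad k Sig (d r))" by (simp only:)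
    have e: "scalar_prod ?a (eps r \<omega>) = (\<Sum>b<k. d r b * vec_index (eps r \<omega>) b)" if "\<omega> \<in> space M" for \<omega>
    proof -
      have "eps r \<omega> \<in> carrier_vec k" using measurable_space[OF eps_measurable that] by (simp add: space_borel_vec)
      then show ?thesis by (simp add: scalar_prod_eq_sum)
    qed
    have m: "(\<lambda>\<omega>. \<Sum>b<k. d r b * vec_index (eps r \<omega>) b) \<in> borel_measurable M"
      by (rule measurable_compose[OF eps_measurable lin])
    show ?thesis by (rule gauss_law_AE_cong[OF g m AE_I2[OF e]])
  qed
  have "gauss_law M (\<lambda>\<omega>. \<Sum>r\<in>J. \<Sum>b<k. d r b * vec_index (eps r \<omega>) b) (\<Sum>r\<in>J. quad k Sig (d r))"
    by (rule gauss_law_indep_sum[OF assms ind one])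
  then show ?thesis by (simp add: innovation_form_def[abs_def])
qed

lemma innovation_form_add:
  assumes "finite J" "finite K"
  shows "innovation_form d J \<omega> + innovation_form e K \<omega> = innovation_form (\<lambda>r b. (if r \<in> J then d r b else 0) + (if r \<in> K then e r b else 0)) (J \<union> K) \<omega>"
proof -
  have ext: "innovation_form d J \<omega> = (\<Sum>r\<in>J \<union> K. \<Sum>b<k. (if r \<in> J then d r b else 0) * vec_index (eps r \<omega>) b)"
    if "finite J" "finite K" for d J K
    unfolding innovation_form_def using that by (intro sum.mono_neutral_cong_left) auto
  show ?thesis
    unfolding ext[OF assms] ext[OF assms(2,1), unfolded Un_commute[of K J]]
    by (simp add: innovation_form_def sum.distrib[symmetric] distrib_right)
qed

lemma innovation_form_scale: "c * innovation_form d J \<omega> = innovation_form (\<lambda>r b. c * d r b) J \<omega>"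
  by (simp add: innovation_form_def sum_distrib_left mult.assoc)

lemma innovation_spaceI:
  assumes "W \<in> borel_measurable M" "\<And>n::nat. finite (J n)" "\<And>n. J n \<subseteq> A"
    "AE \<omega> in M. (\<lambda>n. innovation_form (d n) (J n) \<omega>) \<longlonglongrightarrow> W \<omega>"
  shows "W \<in> innovation_space A"
  using assms unfolding innovation_space_def by blast

lemma innovation_space_mono: "W \<in> innovation_space A \<Longrightarrow> A \<subseteq> B \<Longrightarrow> W \<in> innovation_space B"
  unfolding innovation_space_def by blast

lemma innovation_space_measurable: "W \<in> innovation_space A \<Longrightarrow> W \<in> borel_measurable M"
  unfolding innovation_space_def by blast

lemma innovation_space_add:
  assumes "W \<in> innovation_space A" "V \<in> innovation_space A"
  shows "(\<lambda>\<omega>. W \<omega> + V \<omega>) \<in> innovation_space A"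
proof -
  obtain d J where W: "W \<in> borel_measurable M" "\<And>n::nat. finite (J n)" "\<And>n. J n \<subseteq> A"
    "AE \<omega> in M. (\<lambda>n. innovation_form (d n) (J n) \<omega>) \<longlonglongrightarrow> W \<omega>" using assms(1) unfolding innovation_space_def by blast
  obtain e K where V: "V \<in> borel_measurable M" "\<And>n::nat. finite (K n)" "\<And>n. K n \<subseteq> A"
    "AE \<omega> in M. (\<lambda>n. innovation_form (e n) (K n) \<omega>) \<longlonglongrightarrow> V \<omega>" using assms(2) unfolding innovation_space_def by blast
  show ?thesis
  proof (rule innovation_spaceI)
    show "(\<lambda>\<omega>. W \<omega> + V \<omega>) \<in> borel_measurable M" using W(1) V(1) by simp
    show "finite (J n \<union> K n)" "J n \<union> K n \<subseteq> A" for n using W V by auto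
    show "AE \<omega> in M. (\<lambda>n. innovation_form (\<lambda>r b. (if r \<in> J n then d n r b else 0) + (if r \<in> K n then e n r b else 0)) (J n \<union> K n) \<omega>)
        \<longlonglongrightarrow> W \<omega> + V \<omega>"
      using W(4) V(4) unfolding innovation_form_add[OF W(2) V(2), symmetric]
      by eventually_elim (rule tendsto_add)
  qed
qed

lemma innovation_space_scale:
  assumes "W \<in> innovation_space A" shows "(\<lambda>\<omega>. c * W \<omega>) \<in> innovation_space A"
proof -
  obtain d J where W: "W \<in> borel_measurable M" "\<And>n::nat. finite (J n)" "\<And>n. J n \<subseteq> A"
    "AE \<omega> in M. (\<lambda>n. innovation_form (d n) (J n) \<omega>) \<longlonglongrightarrow> W \<omega>" using assms unfolding innovation_space_def by blast
  show ?thesis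
  proof (rule innovation_spaceI)
    show "AE \<omega> in M. (\<lambda>n. innovation_form (\<lambda>r b. c * d n r b) (J n) \<omega>) \<longlonglongrightarrow> c * W \<omega>"
      using W(4) unfolding innovation_form_scale[symmetric] by eventually_elim (rule tendsto_mult_left)
  qed (use W in auto)
qed

lemma innovation_space_zero: "(\<lambda>_. 0) \<in> innovation_space A"
  by (rule innovation_spaceI[where J="\<lambda>_. {}" and d="\<lambda>_ _ _. 0"]) (auto simp: innovation_form_def)

lemma innovation_space_sum:
  assumes "\<And>i. i \<in> I \<Longrightarrow> W i \<in> innovation_space A"
  shows "(\<lambda>\<omega>. \<Sum>i\<in>I. W i \<omega>) \<in> innovation_space A"
  using assms
proof (induction I rule: infinite_finite_induct)
  case (insert x F)
  then have "W x \<in> innovation_space A" "(\<lambda>\<omega>. \<Sum>i\<in>F. W i \<omega>) \<in> innovation_space A" by simp_all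
  then have "(\<lambda>\<omega>. W x \<omega> + (\<Sum>i\<in>F. W i \<omega>)) \<in> innovation_space A" by (rule innovation_space_add)
  then show ?case using insert by simp
qed (simp_all add: innovation_space_zero)

lemma innovation_space_gauss:
  assumes "W \<in> innovation_space A"
  shows "gauss_law M W (\<integral>\<omega>. (W \<omega>)\<^sup>2 \<partial>M)"
proof -
  obtain d J where W: "W \<in> borel_measurable M" "\<And>n::nat. finite (J n)" "\<And>n. J n \<subseteq> A"
    "AE \<omega> in M. (\<lambda>n. innovation_form (d n) (J n) \<omega>) \<longlonglongrightarrow> W \<omega>" using assms unfolding innovation_space_def by blast
  have "gauss_law M (innovation_form (d n) (J n)) (\<Sum>r\<in>J n. quad k Sig (d n r))" for n by (rule innovation_form_gauss[OF W(2)])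
  from gauss_law_tendsto[where W="\<lambda>n. innovation_form (d n) (J n)", OF this W(1,4)]
  obtain u where u: "gauss_law M W u" by blast
  then show ?thesis using gauss_law_moments(2)[OF u] by simp
qed

lemma innovation_space_integrable:
  assumes "W \<in> innovation_space A" "V \<in> innovation_space B"
  shows "integrable M (\<lambda>\<omega>. W \<omega> * V \<omega>)"
proof -
  have W: "W \<in> innovation_space UNIV" and V: "V \<in> innovation_space UNIV"
    using innovation_space_mono[OF assms(1) subset_UNIV] innovation_space_mono[OF assms(2) subset_UNIV] .
  show ?thesis
    by (rule gauss_law_product(1)[OF innovation_space_gauss[OF W] innovation_space_gauss[OF V] innovation_space_gauss[OF innovation_space_add[OF W V]]])
qed

text \<open>
  For finite linear forms over disjoint sets of times the variances add; by
  \<open>gauss_law_tendsto\<close> the variances of the approximations converge to those of the limits, so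
  they add in the limit too, which says that the covariance is zero.
\<close>

lemma innovation_space_orthogonal:
  assumes WA: "W \<in> innovation_space A" and VB: "V \<in> innovation_space B" and AB: "A \<inter> B = {}"
  shows "(\<integral>\<omega>. W \<omega> * V \<omega> \<partial>M) = 0"
proof -
  obtain d J where W: "W \<in> borel_measurable M" "\<And>n::nat. finite (J n)" "\<And>n. J n \<subseteq> A"
    "AE \<omega> in M. (\<lambda>n. innovation_form (d n) (J n) \<omega>) \<longlonglongrightarrow> W \<omega>" using WA unfolding innovation_space_def by blast
  obtain e K where V: "V \<in> borel_measurable M" "\<And>n::nat. finite (K n)" "\<And>n. K n \<subseteq> B"
    "AE \<omega> in M. (\<lambda>n. innovation_form (e n) (K n) \<omega>) \<longlonglongrightarrow> V \<omega>" using VB unfolding innovation_space_def by blast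
  let ?v = "\<lambda>n. \<Sum>r\<in>J n. quad k Sig (d n r)" and ?w = "\<lambda>n. \<Sum>r\<in>K n. quad k Sig (e n r)"
  let ?f = "\<lambda>n r b. (if r \<in> J n then d n r b else 0) + (if r \<in> K n then e n r b else 0)"
  have sum: "gauss_law M (\<lambda>\<omega>. innovation_form (d n) (J n) \<omega> + innovation_form (e n) (K n) \<omega>) (?v n + ?w n)" for n
  proof -
    have disj: "J n \<inter> K n = {}" using W(3)[of n] V(3)[of n] AB by blast
    then have disj': "\<And>r. r \<in> J n \<Longrightarrow> r \<notin> K n" and disj'': "\<And>r. r \<in> K n \<Longrightarrow> r \<notin> J n" by blast+
    have "(\<Sum>r\<in>J n \<union> K n. quad k Sig (?f n r)) = (\<Sum>r\<in>J n. quad k Sig (?f n r)) + (\<Sum>r\<in>K n. quad k Sig (?f n r))"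
      using W(2) V(2) disj by (rule sum.union_disjoint)
    also have "(\<Sum>r\<in>J n. quad k Sig (?f n r)) = ?v n"
      by (intro sum.cong refl arg_cong[where f="quad k Sig"]) (simp add: disj')
    also have "(\<Sum>r\<in>K n. quad k Sig (?f n r)) = ?w n"
      by (intro sum.cong refl arg_cong[where f="quad k Sig"]) (simp add: disj'')
    finally show ?thesis
      using innovation_form_gauss[of "J n \<union> K n" "?f n"] W(2)[of n] V(2)[of n] by (simp add: innovation_form_add)
  qed
  have "gauss_law M (innovation_form (d n) (J n)) (?v n)" for n by (rule innovation_form_gauss[OF W(2)])
  from gauss_law_tendsto[where W="\<lambda>n. innovation_form (d n) (J n)", OF this W(1,4)]
  obtain v where v: "?v \<longlonglongrightarrow> v" "gauss_law M W v" by blast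
  have "gauss_law M (innovation_form (e n) (K n)) (?w n)" for n by (rule innovation_form_gauss[OF V(2)])
  from gauss_law_tendsto[where W="\<lambda>n. innovation_form (e n) (K n)", OF this V(1,4)]
  obtain w where w: "?w \<longlonglongrightarrow> w" "gauss_law M V w" by blast
  have "AE \<omega> in M. (\<lambda>n. innovation_form (d n) (J n) \<omega> + innovation_form (e n) (K n) \<omega>) \<longlonglongrightarrow> W \<omega> + V \<omega>"
    using W(4) V(4) by eventually_elim (rule tendsto_add)
  from gauss_law_tendsto[where W="\<lambda>n \<omega>. innovation_form (d n) (J n) \<omega> + innovation_form (e n) (K n) \<omega>",
      OF sum borel_measurable_add[OF W(1) V(1)] this]
  obtain u where u: "(\<lambda>n. ?v n + ?w n) \<longlonglongrightarrow> u" "gauss_law M (\<lambda>\<omega>. W \<omega> + V \<omega>) u"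
    by blast
  have "u = v + w" using LIMSEQ_unique[OF u(1) tendsto_add[OF v(1) w(1)]] .
  then show ?thesis using gauss_law_product(2)[OF v(2) w(2) u(2)] by simp
qed

lemma eps_innovation_space:
  assumes "i < k" shows "(\<lambda>\<omega>. vec_index (eps t \<omega>) i) \<in> innovation_space {t}"
proof (rule innovation_spaceI)
  show "(\<lambda>\<omega>. vec_index (eps t \<omega>) i) \<in> borel_measurable M"
    by (rule measurable_compose[OF eps_measurable measurable_vec_index[OF assms]])
  have "innovation_form (\<lambda>r b. if b = i then 1 else 0) {t} \<omega> = vec_index (eps t \<omega>) i" for \<omega>
    using assms by (simp add: innovation_form_def if_distrib[of "\<lambda>x. x * _"] cong: if_cong)
  then show "AE \<omega> in M. (\<lambda>n::nat. innovation_form (\<lambda>r b. if b = i then 1 else 0) {t} \<omega>) \<longlonglongrightarrow> vec_index (eps t \<omega>) i"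
    by simp
qed auto

lemma y_innovation_space:
  assumes "i < k" shows "(\<lambda>\<omega>. vec_index (y t \<omega>) i) \<in> innovation_space {..t}"
proof -
  from causal obtain A :: "nat \<Rightarrow> real mat" where "(\<forall>j. A j \<in> carrier_mat k k) \<and>
      (\<forall>a<k. \<forall>b<k. summable (\<lambda>j. \<bar>A j $$ (a, b)\<bar>)) \<and>
      (\<forall>t. AE \<omega> in M. \<forall>i<k. (\<lambda>j. vec_index (A j *\<^sub>v eps (t - int j) \<omega>) i) sums vec_index (y t \<omega>) i)" ..
  note * = this
  have A: "A j \<in> carrier_mat k k" for j using conjunct1[OF *] by (rule spec)
  have lim: "AE \<omega> in M. \<forall>i<k. (\<lambda>j. vec_index (A j *\<^sub>v eps (t - int j) \<omega>) i) sums vec_index (y t \<omega>) i" for t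
    using conjunct2[OF conjunct2[OF *]] by (rule spec)
  define d where "d r b = A (nat (t - r)) $$ (i, b)" for r b
  define J where "J n = (\<lambda>j. t - int j) ` {..<n}" for n
  show ?thesis
  proof (rule innovation_spaceI)
    show "(\<lambda>\<omega>. vec_index (y t \<omega>) i) \<in> borel_measurable M"
      by (rule measurable_compose[OF y_measurable measurable_vec_index[OF assms]])
    show "finite (J n)" "J n \<subseteq> {..t}" for n by (auto simp: J_def)
    have eq: "innovation_form d (J n) \<omega> = (\<Sum>j<n. vec_index (A j *\<^sub>v eps (t - int j) \<omega>) i)" if "\<omega> \<in> space M" for n \<omega>
    proof -
      have e: "eps r \<omega> \<in> carrier_vec k" for r
        using measurable_space[OF eps_measurable that] by (simp add: space_borel_vec)
      have "inj_on (\<lambda>j. t - int j) {..<n}" by (simp add: inj_on_def)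
      then have "innovation_form d (J n) \<omega> = (\<Sum>j<n. \<Sum>b<k. d (t - int j) b * vec_index (eps (t - int j) \<omega>) b)"
        unfolding innovation_form_def J_def by (subst sum.reindex) (simp_all only: comp_def)
      also have "\<dots> = (\<Sum>j<n. vec_index (A j *\<^sub>v eps (t - int j) \<omega>) i)"
        unfolding mult_mat_vec_index[OF A e assms] by (simp add: d_def)
      finally show ?thesis .
    qed
    show "AE \<omega> in M. (\<lambda>n. innovation_form d (J n) \<omega>) \<longlonglongrightarrow> vec_index (y t \<omega>) i"
      using lim[of t] AE_space
    proof eventually_elim
      case (elim \<omega>)
      from elim(1)[rule_format, OF assms] show ?case unfolding sums_def eq[OF elim(2)] .
    qed
  qed
qed

end

section \<open>Autocovariances of the stacked process\<close>

lemma mat_mult_index: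
  assumes "A \<in> carrier_mat n m" "B \<in> carrier_mat m l" "i < n" "j < l"
  shows "(A * B) $$ (i, j) = (\<Sum>r<m. A $$ (i, r) * B $$ (r, j))"
  using assms by (simp add: scalar_prod_def atLeast0LessThan)

lemma pow_mat_commute_base:
  assumes A: "A \<in> carrier_mat n n"
  shows "A * A ^\<^sub>m h = A ^\<^sub>m h * (A :: 'a :: semiring_1 mat)"
proof (induction h)
  case (Suc h)
  have P: "A ^\<^sub>m h \<in> carrier_mat n n" using A by (rule pow_carrier_mat)
  have "A * A ^\<^sub>m Suc h = (A * A ^\<^sub>m h) * A" using assoc_mult_mat[OF A P A] by simp
  then show ?case unfolding Suc by simp
qed (use A in simp)

lemma sum_blocks:
  fixes f :: "nat \<Rightarrow> nat \<Rightarrow> 'a :: comm_monoid_add"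
  assumes k: "1 \<le> k"
  shows "(\<Sum>l = 1..p. \<Sum>b<k. f l b) = (\<Sum>j<k * p. f (j div k + 1) (j mod k))"
proof -
  have "(\<Sum>l = 1..p. \<Sum>b<k. f l b) = (\<Sum>(l, b)\<in>{1..p} \<times> {..<k}. f l b)"
    by (rule sum.cartesian_product)
  also have "\<dots> = (\<Sum>j<k * p. f (j div k + 1) (j mod k))"
  proof (rule sum.reindex_bij_witness[where i="\<lambda>j. (j div k + 1, j mod k)" and j="\<lambda>(l, b). (l - 1) * k + b"])
    fix x assume x: "x \<in> {1..p} \<times> {..<k}"
    obtain l b where lb: "x = (l, b)" "1 \<le> l" "l \<le> p" "b < k" using x by auto
    have "((l - 1) * k + b) div k = l - 1" "((l - 1) * k + b) mod k = b" using lb by auto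
    then show "(case x of (l, b) \<Rightarrow> (l - 1) * k + b) \<in> {..<k * p}"
      and "((case x of (l, b) \<Rightarrow> (l - 1) * k + b) div k + 1, (case x of (l, b) \<Rightarrow> (l - 1) * k + b) mod k) = x"
      and "f ((case x of (l, b) \<Rightarrow> (l - 1) * k + b) div k + 1) ((case x of (l, b) \<Rightarrow> (l - 1) * k + b) mod k) = (case x of (l, b) \<Rightarrow> f l b)"
    proof -
      have "(l - 1) * k + b < (l - 1) * k + k" using lb by simp
      also have "\<dots> = l * k" using lb by (cases l) auto
      also have "\<dots> \<le> p * k" using lb by (intro mult_right_mono) auto
      finally show "(case x of (l, b) \<Rightarrow> (l - 1) * k + b) \<in> {..<k * p}" using lb by (simp add: mult.commute)
    qed (use lb in auto)
  next
    fix j assume j: "j \<in> {..<k * p}"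
    then have "j div k < p" using k by (simp add: less_mult_imp_div_less mult.commute)
    then show "(j div k + 1, j mod k) \<in> {1..p} \<times> {..<k}" using k by auto
    show "(case (j div k + 1, j mod k) of (l, b) \<Rightarrow> (l - 1) * k + b) = j" by simp
  qed
  finally show ?thesis .
qed

context stationary_gaussian_var
begin

abbreviation F :: "real mat" where "F \<equiv> companion k p Phi"

text \<open>
  Coordinate \<open>m\<close> of \<open>Zvec k p y t\<close>.
\<close>

definition z :: "int \<Rightarrow> nat \<Rightarrow> 'w \<Rightarrow> real" where
  "z t m \<omega> = vec_index (y (t - 1 - int (m div k)) \<omega>) (m mod k)"

definition cov :: "int \<Rightarrow> int \<Rightarrow> nat \<Rightarrow> nat \<Rightarrow> real" where
  "cov t s m m' = (\<integral>\<omega>. z t m \<omega> * z s m' \<omega> \<partial>M)"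

lemma F_carrier: "F \<in> carrier_mat (k * p) (k * p)"
  by (simp add: companion_def)

lemma kp_pos: "0 < k * p" using k_pos p_pos by simp

lemma z_innovation_space: "z t m \<in> innovation_space {..t - 1}"
proof -
  have "m mod k < k" using k_pos by simp
  from y_innovation_space[OF this, of "t - 1 - int (m div k)"]
  have "z t m \<in> innovation_space {..t - 1 - int (m div k)}" by (simp add: z_def[abs_def])
  then show ?thesis by (rule innovation_space_mono) auto
qed

lemma cov_shift: "cov (t + h) (s + h) m m' = cov t s m m'"
proof -
  let ?P = "\<Pi>\<^sub>M t\<in>(UNIV :: int set). borel_vec k"
  let ?f = "\<lambda>x :: int \<Rightarrow> real vec. vec_index (x (t - 1 - int (m div k))) (m mod k) * vec_index (x (s - 1 - int (m' div k))) (m' mod k)"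
  have c: "(\<lambda>x :: int \<Rightarrow> real vec. vec_index (x a) (n mod k)) \<in> borel_measurable ?P" for a n
    by (rule measurable_compose[OF measurable_component_singleton[of a] measurable_vec_index]) (use k_pos in auto)
  have f: "?f \<in> borel_measurable ?P" by (rule borel_measurable_times[OF c c])
  have Y: "(\<lambda>\<omega> t. y (t + h) \<omega>) \<in> measurable M ?P" for h
    by (rule measurable_abs_UNIV) (rule y_measurable)
  have "integral\<^sup>L (distr M ?P (\<lambda>\<omega> t. y (t + h) \<omega>)) ?f = cov (t + h) (s + h) m m'"
    by (subst integral_distr[OF Y f]) (simp add: cov_def z_def algebra_simps)
  moreover have "integral\<^sup>L (distr M ?P (\<lambda>\<omega> t. y (t + 0) \<omega>)) ?f = cov t s m m'"
    by (subst integral_distr[OF Y f]) (simp add: cov_def z_def)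
  ultimately show ?thesis using stationary[of h] by simp
qed

text \<open>
  The companion form \<open>Z\<^sub>t\<^sub>+\<^sub>1 = F Z\<^sub>t + (\<epsilon>\<^sub>t, 0, \<dots>, 0)\<close>.
\<close>

lemma z_recursion:
  assumes m: "m < k * p"
  shows "AE \<omega> in M. z (t + 1) m \<omega> =
    (\<Sum>l<k * p. F $$ (m, l) * z t l \<omega>) + (if m < k then vec_index (eps t \<omega>) m else 0)"
proof (cases "m < k")
  case True
  show ?thesis
    using var_equation[of t] AE_space
  proof eventually_elim
    case (elim \<omega>)
    have yc: "y r \<omega> \<in> carrier_vec k" for r
      using measurable_space[OF y_measurable elim(2)] by (simp add: space_borel_vec)
    have "(\<Sum>l = 1..p. vec_index (Phi l *\<^sub>v y (t - int l) \<omega>) m)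
        = (\<Sum>l = 1..p. \<Sum>b<k. Phi l $$ (m, b) * vec_index (y (t - int l) \<omega>) b)"
      by (intro sum.cong refl mult_mat_vec_index[OF Phi_carrier yc True]) simp
    also have "\<dots> = (\<Sum>j<k * p. Phi (j div k + 1) $$ (m, j mod k) * vec_index (y (t - int (j div k + 1)) \<omega>) (j mod k))"
      by (rule sum_blocks[OF k_pos])
    also have "\<dots> = (\<Sum>l<k * p. F $$ (m, l) * z t l \<omega>)"
    proof (intro sum.cong refl)
      fix j assume j: "j \<in> {..<k * p}"
      have "F $$ (m, j) = Phi (j div k + 1) $$ (m, j mod k)" using True m j by (simp add: companion_def)
      moreover have "t - int (j div k + 1) = t - 1 - int (j div k)" by simp
      ultimately show "Phi (j div k + 1) $$ (m, j mod k) * vec_index (y (t - int (j div k + 1)) \<omega>) (j mod k) = F $$ (m, j) * z t j \<omega>"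
        by (simp only: z_def)
    qed
    finally have "(\<Sum>l = 1..p. vec_index (Phi l *\<^sub>v y (t - int l) \<omega>) m) = (\<Sum>l<k * p. F $$ (m, l) * z t l \<omega>)" .
    moreover have "z (t + 1) m \<omega> = vec_index (y t \<omega>) m" using True by (simp add: z_def)
    ultimately show ?case using elim(1)[rule_format, OF True] True by simp
  qed
next
  case False
  have "z (t + 1) m \<omega> = (\<Sum>l<k * p. F $$ (m, l) * z t l \<omega>)" for \<omega>
  proof -
    have "(\<Sum>l<k * p. F $$ (m, l) * z t l \<omega>) = (\<Sum>l<k * p. if l = m - k then z t l \<omega> else 0)"
      using False m by (intro sum.cong refl) (simp add: companion_def)
    also have "\<dots> = z t (m - k) \<omega>" using m False by simp
    also have "\<dots> = z (t + 1) m \<omega>"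
    proof -
      have "m div k = (m - k) div k + 1" "(m - k) mod k = m mod k"
        using False k_pos by (simp_all add: le_div_geq le_mod_geq)
      then show ?thesis by (simp add: z_def algebra_simps)
    qed
    finally show ?thesis ..
  qed
  then show ?thesis using False by simp
qed

text \<open>
  The innovation \<open>\<epsilon>\<^sub>t\<close> is orthogonal to \<open>Z\<^sub>s\<close>, which only involves times before \<open>t\<close>.
\<close>

lemma cov_step:
  assumes m: "m < k * p" and st: "s \<le> t"
  shows "cov (t + 1) s m m' = (\<Sum>l<k * p. F $$ (m, l) * cov t s l m')"
proof -
  let ?e = "\<lambda>\<omega>. if m < k then vec_index (eps t \<omega>) m else 0"
  have e: "?e \<in> innovation_space {t}"
    by (cases "m < k") (simp_all add: eps_innovation_space innovation_space_zero)
  have zs: "z s m' \<in> innovation_space {..t - 1}" using z_innovation_space[of s m'] by (rule innovation_space_mono) (use st in auto)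
  have L: "(\<lambda>\<omega>. \<Sum>l<k * p. F $$ (m, l) * z t l \<omega>) \<in> innovation_space {..t - 1}"
    by (intro innovation_space_sum innovation_space_scale z_innovation_space)
  have "cov (t + 1) s m m' = (\<integral>\<omega>. (\<Sum>l<k * p. F $$ (m, l) * z t l \<omega>) * z s m' \<omega> + ?e \<omega> * z s m' \<omega> \<partial>M)"
    unfolding cov_def
  proof (rule integral_cong_AE)
    show "AE \<omega> in M. z (t + 1) m \<omega> * z s m' \<omega> = (\<Sum>l<k * p. F $$ (m, l) * z t l \<omega>) * z s m' \<omega> + ?e \<omega> * z s m' \<omega>"
      using z_recursion[OF m, of t] by eventually_elim (simp only: distrib_right)
    show "(\<lambda>\<omega>. z (t + 1) m \<omega> * z s m' \<omega>) \<in> borel_measurable M"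
      by (intro borel_measurable_times innovation_space_measurable[OF z_innovation_space])
    show "(\<lambda>\<omega>. (\<Sum>l<k * p. F $$ (m, l) * z t l \<omega>) * z s m' \<omega> + ?e \<omega> * z s m' \<omega>) \<in> borel_measurable M"
      by (intro borel_measurable_add borel_measurable_times innovation_space_measurable[OF L] innovation_space_measurable[OF z_innovation_space] innovation_space_measurable[OF e])
  qed
  also have "\<dots> = (\<integral>\<omega>. (\<Sum>l<k * p. F $$ (m, l) * z t l \<omega>) * z s m' \<omega> \<partial>M) + (\<integral>\<omega>. ?e \<omega> * z s m' \<omega> \<partial>M)"
    by (rule Bochner_Integration.integral_add[OF innovation_space_integrable[OF L zs] innovation_space_integrable[OF e zs]])
  also have "(\<integral>\<omega>. ?e \<omega> * z s m' \<omega> \<partial>M) = 0" by (rule innovation_space_orthogonal[OF e zs]) simp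
  also have "(\<integral>\<omega>. (\<Sum>l<k * p. F $$ (m, l) * z t l \<omega>) * z s m' \<omega> \<partial>M) = (\<integral>\<omega>. (\<Sum>l<k * p. F $$ (m, l) * (z t l \<omega> * z s m' \<omega>)) \<partial>M)"
    by (simp add: sum_distrib_right mult.assoc)
  also have "\<dots> = (\<Sum>l<k * p. F $$ (m, l) * cov t s l m')"
    unfolding cov_def
    by (subst Bochner_Integration.integral_sum) (auto intro!: integrable_mult_right innovation_space_integrable[OF z_innovation_space z_innovation_space])
  finally show ?thesis by simp
qed

lemma Psi_index:
  assumes "i < k * p" "j < k * p"
  shows "Psi k p T y \<omega> $$ (i, j) = (\<Sum>r<T. z (int T - int r) i \<omega> * z (int T - int r) j \<omega>) / T"
proof -
  have X: "Xmat k p T y \<omega> \<in> carrier_mat T (k * p)" by (simp add: Xmat_def)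
  have Xi: "Xmat k p T y \<omega> $$ (r, l) = z (int T - int r) l \<omega>" if "r < T" "l < k * p" for r l
    using that by (simp add: Xmat_def Zvec_def z_def)
  have "(transpose_mat (Xmat k p T y \<omega>) * Xmat k p T y \<omega>) $$ (i, j) = (\<Sum>r<T. z (int T - int r) i \<omega> * z (int T - int r) j \<omega>)"
    by (subst mat_mult_index[OF transpose_carrier_mat[THEN iffD2, OF X] X assms])
      (intro sum.cong refl, use X assms in \<open>simp add: Xi\<close>)
  then show ?thesis using X assms by (simp add: Psi_def)
qed

lemma Psi_carrier: "Psi k p T y \<omega> \<in> carrier_mat (k * p) (k * p)"
  by (rule carrier_matI) (simp_all add: Psi_def Xmat_def)

lemma Psi_sym: "i < k * p \<Longrightarrow> j < k * p \<Longrightarrow> Psi k p T y \<omega> $$ (i, j) = Psi k p T y \<omega> $$ (j, i)"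
  by (simp add: Psi_index mult.commute)

lemma Gam_carrier: "Gam M k p T y \<in> carrier_mat (k * p) (k * p)"
  by (simp add: Gam_def)

lemma Gam_index:
  assumes T: "1 \<le> T" and ij: "i < k * p" "j < k * p"
  shows "Gam M k p T y $$ (i, j) = cov t t i j"
proof -
  have "Gam M k p T y $$ (i, j) = (\<integral>\<omega>. (\<Sum>r<T. z (int T - int r) i \<omega> * z (int T - int r) j \<omega>) / T \<partial>M)"
    using ij by (simp add: Gam_def Psi_index)
  also have "\<dots> = (\<Sum>r<T. cov (int T - int r) (int T - int r) i j) / T"
    unfolding cov_def integral_divide_zero
    by (subst Bochner_Integration.integral_sum) (auto intro!: innovation_space_integrable[OF z_innovation_space z_innovation_space])
  also have "\<dots> = (\<Sum>r<T. cov t t i j) / T"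
  proof -
    have "cov (int T - int r) (int T - int r) i j = cov t t i j" for r
      using cov_shift[of t "int T - int r - t" t i j] by simp
    then show ?thesis by simp
  qed
  also have "\<dots> = cov t t i j" using T by simp
  finally show ?thesis .
qed

text \<open>
  Iteration of the companion recursion, starting from \<open>E(Z\<^sub>s Z\<^sub>s') = \<Gamma>\<close>, which holds at every time by
  stationarity.
\<close>

lemma cov_eq_power:
  assumes T: "1 \<le> T" and m: "m < k * p" "m' < k * p"
  shows "cov (s + int h) s m m' = (F ^\<^sub>m h * Gam M k p T y) $$ (m, m')"
  using m(1)
proof (induction h arbitrary: m)
  case 0
  have "F ^\<^sub>m 0 * Gam M k p T y = Gam M k p T y"
    using left_mult_one_mat[OF Gam_carrier] by (simp add: companion_def)
  then show ?case using Gam_index[OF T 0 m(2), of s] by simp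
next
  case (Suc h)
  have P: "F ^\<^sub>m h \<in> carrier_mat (k * p) (k * p)" by (rule pow_carrier_mat[OF F_carrier])
  have PG: "F ^\<^sub>m h * Gam M k p T y \<in> carrier_mat (k * p) (k * p)" by (rule mult_carrier_mat[OF P Gam_carrier])
  have "s + int (Suc h) = (s + int h) + 1" by simp
  then have "cov (s + int (Suc h)) s m m' = (\<Sum>l<k * p. F $$ (m, l) * cov (s + int h) s l m')"
    using cov_step[OF Suc.prems, of s "s + int h" m'] by (simp only:)
  also have "\<dots> = (\<Sum>l<k * p. F $$ (m, l) * (F ^\<^sub>m h * Gam M k p T y) $$ (l, m'))"
    by (intro sum.cong refl arg_cong2[where f="(*)"] Suc.IH) simp
  also have "\<dots> = (F * (F ^\<^sub>m h * Gam M k p T y)) $$ (m, m')"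
    by (rule mat_mult_index[OF F_carrier PG Suc.prems m(2), symmetric])
  also have "F * (F ^\<^sub>m h * Gam M k p T y) = F ^\<^sub>m Suc h * Gam M k p T y"
    using assoc_mult_mat[OF F_carrier P Gam_carrier] pow_mat_commute_base[OF F_carrier, of h] by simp
  finally show ?case .
qed

lemma lincomb_innovation_space: "(\<lambda>\<omega>. \<Sum>m<k * p. u m * z t m \<omega>) \<in> innovation_space {..t - 1}"
  by (intro innovation_space_sum innovation_space_scale z_innovation_space)

lemma lincomb_cov:
  "(\<integral>\<omega>. (\<Sum>m<k * p. u m * z t m \<omega>) * (\<Sum>m<k * p. u m * z s m \<omega>) \<partial>M)
    = (\<Sum>i<k * p. \<Sum>j<k * p. u i * cov t s i j * u j)"
proof -
  have "(\<integral>\<omega>. (\<Sum>m<k * p. u m * z t m \<omega>) * (\<Sum>m<k * p. u m * z s m \<omega>) \<partial>M)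
      = (\<integral>\<omega>. (\<Sum>i<k * p. \<Sum>j<k * p. (u i * u j) * (z t i \<omega> * z s j \<omega>)) \<partial>M)"
    unfolding sum_product by (intro Bochner_Integration.integral_cong refl sum.cong) (simp add: mult_ac)
  also have "\<dots> = (\<Sum>i<k * p. \<Sum>j<k * p. (u i * u j) * cov t s i j)"
    unfolding cov_def
    by (simp add: Bochner_Integration.integral_sum Bochner_Integration.integrable_sum integrable_mult_right
        innovation_space_integrable[OF z_innovation_space z_innovation_space])
  finally show ?thesis by (simp add: mult_ac)
qed

lemma psd_Gam:
  assumes T: "1 \<le> T" shows "psd (k * p) (Gam M k p T y)"
  unfolding psd_def
proof (intro conjI allI impI)
  fix i j assume "i < k * p" "j < k * p"
  then show "Gam M k p T y $$ (i, j) = Gam M k p T y $$ (j, i)"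
    using Gam_index[OF T, of _ _ 0] by (simp add: cov_def mult.commute)
next
  fix x :: "nat \<Rightarrow> real"
  have "quad (k * p) (Gam M k p T y) x = (\<Sum>i<k * p. \<Sum>j<k * p. x i * cov 0 0 i j * x j)"
    unfolding quad_def by (intro sum.cong refl) (simp add: Gam_index[OF T, of _ _ 0])
  also have "\<dots> = (\<integral>\<omega>. (\<Sum>m<k * p. x m * z 0 m \<omega>) * (\<Sum>m<k * p. x m * z 0 m \<omega>) \<partial>M)"
    by (rule lincomb_cov[symmetric])
  also have "\<dots> \<ge> 0" by (intro Bochner_Integration.integral_nonneg) simp
  finally show "0 \<le> quad (k * p) (Gam M k p T y) x" .
qed (rule Gam_carrier)

end

section \<open>Deviation of the empirical second moments\<close>

context stationary_gaussian_var
begin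

text \<open>
  The quantity whose square divides \<open>zeta\<close>.  It bounds the sums of autocovariances of \<open>u'Z\<^sub>t\<close> over the sample, for
  unit vectors \<open>u\<close>.
\<close>

definition dependence_factor :: "nat \<Rightarrow> real" where
  "dependence_factor T = spectral_norm (Gam M k p T y) * (\<Sum>i = 0..T. spectral_norm (F ^\<^sub>m i))"

lemma lag_covariance_bound:
  assumes T: "1 \<le> T"
  shows "\<bar>\<integral>\<omega>. (\<Sum>m<k * p. u m * z (s + int h) m \<omega>) * (\<Sum>m<k * p. u m * z s m \<omega>) \<partial>M\<bar>
    \<le> (\<Sum>m<k * p. (u m)\<^sup>2) * (spectral_norm (Gam M k p T y) * spectral_norm (F ^\<^sub>m h))"
proof -
  have "(\<integral>\<omega>. (\<Sum>m<k * p. u m * z (s + int h) m \<omega>) * (\<Sum>m<k * p. u m * z s m \<omega>) \<partial>M)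
      = quad (k * p) (F ^\<^sub>m h * Gam M k p T y) u"
    unfolding lincomb_cov quad_def by (intro sum.cong refl) (simp add: cov_eq_power[OF T])
  then show ?thesis
    using abs_quad_mult_le[OF pow_carrier_mat[OF F_carrier] Gam_carrier kp_pos, of h T u]
    by (simp add: mult_ac)
qed

lemma spectral_norm_pow_nonneg: "0 \<le> spectral_norm (F ^\<^sub>m i)"
  by (rule spectral_norm_nonneg[OF pow_carrier_mat[OF F_carrier] kp_pos])

lemma spectral_norm_Gam_nonneg: "0 \<le> spectral_norm (Gam M k p T y)"
  by (rule spectral_norm_nonneg[OF Gam_carrier kp_pos])

lemma spectral_norm_Gam_le_dependence_factor: "spectral_norm (Gam M k p T y) \<le> dependence_factor T"
proof -
  have "F ^\<^sub>m 0 = 1\<^sub>m (k * p)" by (simp add: companion_def)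
  then have "1 = spectral_norm (F ^\<^sub>m 0)" using spectral_norm_one[OF kp_pos] by simp
  also have "\<dots> \<le> (\<Sum>i = 0..T. spectral_norm (F ^\<^sub>m i))"
    by (rule member_le_sum) (use spectral_norm_pow_nonneg in auto)
  finally show ?thesis unfolding dependence_factor_def
    using mult_left_mono[OF _ spectral_norm_Gam_nonneg, of 1 "\<Sum>i = 0..T. spectral_norm (F ^\<^sub>m i)" T] by simp
qed

text \<open>
  The covariance of \<open>u'Z\<^sub>r\<close> and \<open>u'Z\<^sub>s\<close> is at most \<open>\<parallel>u\<parallel>\<^sup>2 * \<parallel>\<Gamma>\<parallel> * \<parallel>F\<^bsup>|r - s|\<^esup>\<parallel>\<close>.  A row or column of
  one triangle of the covariance matrix contains every lag at most once, so its absolute sum is at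
  most \<open>K = \<parallel>u\<parallel>\<^sup>2 * dependence_factor T\<close>.
\<close>

lemma quadratic_deviation:
  fixes u :: "nat \<Rightarrow> real"
  defines "c \<equiv> (\<Sum>m<k * p. (u m)\<^sup>2)"
  assumes T: "1 \<le> T" and c: "0 < c" and G: "0 < dependence_factor T" and x: "0 < x" "x \<le> c * dependence_factor T"
  shows "prob {\<omega> \<in> space M. real T * x \<le> \<bar>(\<Sum>r<T. (\<Sum>m<k * p. u m * z (int T - int r) m \<omega>)\<^sup>2) - real T * quad (k * p) (Gam M k p T y) u\<bar>}
    \<le> 2 * exp (- (real T * x\<^sup>2 / (64 * (c * dependence_factor T)\<^sup>2)))"
proof -
  \<comment> \<open>Row \<open>r\<close> of the design matrix belongs to time \<open>T - r\<close>.\<close>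
  define X where "X r \<omega> = (\<Sum>m<k * p. u m * z (int T - int r) m \<omega>)" for r and \<omega>
  define S where "S r s = (\<integral>\<omega>. X r \<omega> * X s \<omega> \<partial>M)" for r s
  define f where "f h = c * (spectral_norm (Gam M k p T y) * spectral_norm (F ^\<^sub>m h))" for h
  have f0: "0 \<le> f h" for h
    unfolding f_def using c spectral_norm_pow_nonneg spectral_norm_Gam_nonneg by auto
  have Xg: "X r \<in> innovation_space UNIV" for r
  proof -
    have "X r \<in> innovation_space {..int T - int r - 1}" unfolding X_def[abs_def] by (rule lincomb_innovation_space)
    then show ?thesis by (rule innovation_space_mono) simp
  qed
  have sym: "S r s = S s r" for r s by (simp add: S_def mult.commute)
  have bound: "\<bar>S r s\<bar> \<le> f (s - r)" if "r \<le> s" for r s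
  proof -
    have "int T - int r = int T - int s + int (s - r)" using that by simp
    then show ?thesis
      using lag_covariance_bound[OF T, of u "int T - int s" "s - r"] unfolding S_def X_def f_def c_def by (simp only:)
  qed
  have fsum: "(\<Sum>h\<in>H. f h) \<le> c * dependence_factor T" if "H \<subseteq> {0..T}" for H
  proof -
    have "(\<Sum>h\<in>H. f h) \<le> (\<Sum>h = 0..T. f h)" using that f0 by (intro sum_mono2) auto
    then show ?thesis by (simp add: f_def dependence_factor_def sum_distrib_left)
  qed
  have row: "(\<Sum>s\<le>r. \<bar>S r s\<bar>) \<le> c * dependence_factor T" if "r < T" for r
  proof -
    have "(\<Sum>s\<le>r. \<bar>S r s\<bar>) \<le> (\<Sum>s\<le>r. f (r - s))"
    proof (intro sum_mono)
      fix s assume "s \<in> {..r}"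
      then show "\<bar>S r s\<bar> \<le> f (r - s)" using bound[of s r] sym[of r s] by simp
    qed
    also have "\<dots> = (\<Sum>h\<in>(\<lambda>s. r - s) ` {..r}. f h)"
      by (subst sum.reindex) (auto simp: inj_on_def)
    also have "\<dots> \<le> c * dependence_factor T" by (rule fsum) (use that in auto)
    finally show ?thesis .
  qed
  have col: "(\<Sum>r\<in>{s..<T}. \<bar>S r s\<bar>) \<le> c * dependence_factor T" if "s < T" for s
  proof -
    have "(\<Sum>r\<in>{s..<T}. \<bar>S r s\<bar>) \<le> (\<Sum>r\<in>{s..<T}. f (r - s))"
    proof (intro sum_mono)
      fix r assume "r \<in> {s..<T}"
      then show "\<bar>S r s\<bar> \<le> f (r - s)" using bound[of s r] sym[of r s] by simp
    qed
    also have "\<dots> = (\<Sum>h\<in>(\<lambda>r. r - s) ` {s..<T}. f h)"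
      by (subst sum.reindex) (auto simp: inj_on_def)
    also have "\<dots> \<le> c * dependence_factor T" by (rule fsum) auto
    finally show ?thesis .
  qed
  have gauss: "gauss_law M (\<lambda>\<omega>. \<Sum>r<T. a r * X r \<omega>) (\<Sum>r<T. \<Sum>s<T. S r s * a r * a s)" for a
  proof -
    have g: "(\<lambda>\<omega>. \<Sum>r<T. a r * X r \<omega>) \<in> innovation_space UNIV" by (intro innovation_space_sum innovation_space_scale Xg)
    have "(\<integral>\<omega>. (\<Sum>r<T. a r * X r \<omega>)\<^sup>2 \<partial>M) = (\<integral>\<omega>. (\<Sum>r<T. \<Sum>s<T. (a r * a s) * (X r \<omega> * X s \<omega>)) \<partial>M)"
      unfolding power2_eq_square sum_product by (intro Bochner_Integration.integral_cong refl sum.cong) (simp add: mult_ac)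
    also have "\<dots> = (\<Sum>r<T. \<Sum>s<T. (a r * a s) * S r s)"
      unfolding S_def
      by (simp add: Bochner_Integration.integral_sum Bochner_Integration.integrable_sum integrable_mult_right
          innovation_space_integrable[OF Xg Xg])
    finally have "(\<integral>\<omega>. (\<Sum>r<T. a r * X r \<omega>)\<^sup>2 \<partial>M) = (\<Sum>r<T. \<Sum>s<T. S r s * a r * a s)" by (simp add: mult_ac)
    then show ?thesis using innovation_space_gauss[OF g] by simp
  qed
  have trace: "(\<Sum>r<T. S r r) = real T * quad (k * p) (Gam M k p T y) u"
  proof -
    have "S r r = quad (k * p) (Gam M k p T y) u" for r
      unfolding S_def X_def lincomb_cov quad_def
      by (intro sum.cong refl) (simp add: Gam_index[OF T, of _ _ "int T - int r"])
    then show ?thesis by simp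
  qed
  have K: "0 < c * dependence_factor T" using c G by simp
  show ?thesis
    using gauss_sum_squares_deviation[of X T S, OF gauss sym row col K x] unfolding trace X_def by simp
qed

text \<open>
  An off-diagonal entry is polarised, \<open>4 Z\<^sub>i Z\<^sub>j = (Z\<^sub>i + Z\<^sub>j)\<^sup>2 - (Z\<^sub>i - Z\<^sub>j)\<^sup>2\<close>.  A deviation by \<open>a\<close> forces
  one of the two mean squares to deviate by \<open>2 * a\<close>, and the vectors \<open>e\<^sub>i \<plusminus> e\<^sub>j\<close> have squared length
  2; the two factors 2 cancel in the exponent.  A diagonal entry is a sum of squares already.
\<close>

lemma entry_deviation:
  assumes T: "1 \<le> T" and ij: "i < k * p" "j < k * p" and G: "0 < dependence_factor T" and a: "0 < a" "a \<le> dependence_factor T"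
  shows "prob {\<omega> \<in> space M. a < \<bar>Psi k p T y \<omega> $$ (i, j) - Gam M k p T y $$ (i, j)\<bar>}
    \<le> 4 * exp (- (real T * a\<^sup>2 / (64 * (dependence_factor T)\<^sup>2)))"
proof -
  let ?N = "k * p" and ?C = "Gam M k p T y"
  define e where "e l m = (if m = l then 1 else 0 :: real)" for l m :: nat
  have sum_e: "(\<Sum>m<?N. e l m * g m) = g l" if "l < ?N" for l g
    using that by (simp add: e_def if_distrib[of "\<lambda>x. x * _"] cong: if_cong)
  have quad_e: "(\<Sum>m<?N. \<Sum>n<?N. e l m * ?C $$ (m, n) * e l' n) = ?C $$ (l, l')" if "l < ?N" "l' < ?N" for l l'
  proof -
    have "(\<Sum>m<?N. \<Sum>n<?N. e l m * ?C $$ (m, n) * e l' n) = (\<Sum>m<?N. e l m * (\<Sum>n<?N. e l' n * ?C $$ (m, n)))"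
      by (simp add: sum_distrib_left mult_ac)
    then show ?thesis by (simp add: sum_e that)
  qed
  define D where "D u \<omega> = (\<Sum>r<T. (\<Sum>m<?N. u m * z (int T - int r) m \<omega>)\<^sup>2) - real T * quad ?N ?C u" for u \<omega>
  have Dm: "D u \<in> borel_measurable M" for u
    unfolding D_def
    by (intro borel_measurable_diff borel_measurable_sum borel_measurable_power borel_measurable_const innovation_space_measurable[OF lincomb_innovation_space])
  have meas: "{\<omega> \<in> space M. b \<le> \<bar>D u \<omega>\<bar>} \<in> sets M" for u b
    using Dm[of u] by measurable
  define E where "E = exp (- (real T * a\<^sup>2 / (64 * (dependence_factor T)\<^sup>2)))"
  have E0: "0 \<le> E" by (simp add: E_def)
  define dev where "dev \<omega> = real T * (Psi k p T y \<omega> $$ (i, j) - ?C $$ (i, j))" for \<omega>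
  have dev: "dev \<omega> = (\<Sum>r<T. z (int T - int r) i \<omega> * z (int T - int r) j \<omega>) - real T * ?C $$ (i, j)" for \<omega>
    unfolding dev_def Psi_index[OF ij] using T by (simp add: algebra_simps)
  have ev: "{\<omega> \<in> space M. a < \<bar>Psi k p T y \<omega> $$ (i, j) - ?C $$ (i, j)\<bar>} \<subseteq> {\<omega> \<in> space M. real T * a \<le> \<bar>dev \<omega>\<bar>}"
    using T unfolding dev_def abs_mult by auto
  show ?thesis
  proof (cases "i = j")
    case True
    have De: "D (e i) \<omega> = dev \<omega>" for \<omega>
      unfolding D_def dev quad_def using True quad_e[OF ij(1) ij(1)] by (simp add: sum_e ij power2_eq_square)
    have c1: "(\<Sum>m<?N. (e i m)\<^sup>2) = 1"
      using sum_e[OF ij(1), of "e i"] by (simp add: power2_eq_square e_def)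
    have "prob {\<omega> \<in> space M. a < \<bar>Psi k p T y \<omega> $$ (i, j) - ?C $$ (i, j)\<bar>} \<le> prob {\<omega> \<in> space M. real T * a \<le> \<bar>D (e i) \<omega>\<bar>}"
      by (rule finite_measure_mono[OF _ meas]) (use ev in \<open>simp only: De\<close>)
    also have "\<dots> \<le> 2 * E"
      using quadratic_deviation[OF T, of "e i" a] G a unfolding c1 E_def D_def by simp
    also have "\<dots> \<le> 4 * E" using E0 by simp
    finally show ?thesis by (simp only: E_def)
  next
    case False
    define up where "up m = e i m + e j m" for m
    define um where "um m = e i m - e j m" for m
    have su: "(\<Sum>m<?N. up m * g m) = g i + g j" "(\<Sum>m<?N. um m * g m) = g i - g j" for g
      by (simp_all add: up_def um_def distrib_right left_diff_distrib sum.distrib sum_subtractf sum_e ij)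
    have c2: "(\<Sum>m<?N. (up m)\<^sup>2) = 2" "(\<Sum>m<?N. (um m)\<^sup>2) = 2"
      using su(1)[of up] su(2)[of um] False by (simp_all add: power2_eq_square up_def um_def e_def)
    have sym: "?C $$ (j, i) = ?C $$ (i, j)" using psd_Gam[OF T] ij by (simp add: psd_def)
    have q: "quad ?N ?C up = ?C $$ (i, i) + 2 * ?C $$ (i, j) + ?C $$ (j, j)"
      "quad ?N ?C um = ?C $$ (i, i) - 2 * ?C $$ (i, j) + ?C $$ (j, j)"
    proof -
      have "quad ?N ?C up = (\<Sum>m<?N. up m * (\<Sum>n<?N. up n * ?C $$ (m, n)))"
        "quad ?N ?C um = (\<Sum>m<?N. um m * (\<Sum>n<?N. um n * ?C $$ (m, n)))"
        by (simp_all add: quad_def sum_distrib_left mult_ac)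
      then show "quad ?N ?C up = ?C $$ (i, i) + 2 * ?C $$ (i, j) + ?C $$ (j, j)"
        "quad ?N ?C um = ?C $$ (i, i) - 2 * ?C $$ (i, j) + ?C $$ (j, j)"
        by (simp_all add: su sym)
    qed
    have polar: "4 * dev \<omega> = D up \<omega> - D um \<omega>" for \<omega>
    proof -
      have "4 * (\<Sum>r<T. z (int T - int r) i \<omega> * z (int T - int r) j \<omega>)
          = (\<Sum>r<T. (z (int T - int r) i \<omega> + z (int T - int r) j \<omega>)\<^sup>2)
            - (\<Sum>r<T. (z (int T - int r) i \<omega> - z (int T - int r) j \<omega>)\<^sup>2)"
        unfolding sum_subtractf[symmetric] sum_distrib_left
        by (intro sum.cong refl) (simp add: power2_eq_square algebra_simps)
      then show ?thesis unfolding D_def dev su q by (simp add: algebra_simps)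
    qed
    have sub: "{\<omega> \<in> space M. a < \<bar>Psi k p T y \<omega> $$ (i, j) - ?C $$ (i, j)\<bar>}
        \<subseteq> {\<omega> \<in> space M. real T * (2 * a) \<le> \<bar>D up \<omega>\<bar>} \<union> {\<omega> \<in> space M. real T * (2 * a) \<le> \<bar>D um \<omega>\<bar>}"
    proof
      fix \<omega> assume "\<omega> \<in> {\<omega> \<in> space M. a < \<bar>Psi k p T y \<omega> $$ (i, j) - ?C $$ (i, j)\<bar>}"
      then have w: "\<omega> \<in> space M" "real T * a \<le> \<bar>dev \<omega>\<bar>" using ev by auto
      have "real T * (2 * a) \<le> \<bar>D up \<omega>\<bar> \<or> real T * (2 * a) \<le> \<bar>D um \<omega>\<bar>"
        using w(2) polar[of \<omega>] by (auto simp: abs_if split: if_splits)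
      then show "\<omega> \<in> {\<omega> \<in> space M. real T * (2 * a) \<le> \<bar>D up \<omega>\<bar>} \<union> {\<omega> \<in> space M. real T * (2 * a) \<le> \<bar>D um \<omega>\<bar>}"
        using w(1) by auto
    qed
    have tail: "prob {\<omega> \<in> space M. real T * (2 * a) \<le> \<bar>D u \<omega>\<bar>} \<le> 2 * E" if "(\<Sum>m<?N. (u m)\<^sup>2) = 2" for u
    proof -
      have "prob {\<omega> \<in> space M. real T * (2 * a) \<le> \<bar>D u \<omega>\<bar>} \<le> 2 * exp (- (real T * (2 * a)\<^sup>2 / (64 * (2 * dependence_factor T)\<^sup>2)))"
        using quadratic_deviation[OF T, of u "2 * a"] G a unfolding that D_def by simp
      also have "real T * (2 * a)\<^sup>2 / (64 * (2 * dependence_factor T)\<^sup>2) = real T * a\<^sup>2 / (64 * (dependence_factor T)\<^sup>2)"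
        by (simp add: power_mult_distrib)
      finally show ?thesis by (simp only: E_def)
    qed
    have "prob {\<omega> \<in> space M. a < \<bar>Psi k p T y \<omega> $$ (i, j) - ?C $$ (i, j)\<bar>}
        \<le> prob ({\<omega> \<in> space M. real T * (2 * a) \<le> \<bar>D up \<omega>\<bar>} \<union> {\<omega> \<in> space M. real T * (2 * a) \<le> \<bar>D um \<omega>\<bar>})"
      by (rule finite_measure_mono[OF sub]) (intro sets.Un meas)
    also have "\<dots> \<le> prob {\<omega> \<in> space M. real T * (2 * a) \<le> \<bar>D up \<omega>\<bar>} + prob {\<omega> \<in> space M. real T * (2 * a) \<le> \<bar>D um \<omega>\<bar>}"
      by (rule measure_Un_le[OF meas meas])
    also have "\<dots> \<le> 4 * E" using tail[OF c2(1)] tail[OF c2(2)] by simp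
    finally show ?thesis by (simp only: E_def)
  qed
qed

lemma C_event_iff:
  "\<omega> \<in> C_event M k p T y q s \<longleftrightarrow> \<omega> \<in> space M \<and>
     (\<forall>i<k * p. \<forall>j<k * p. \<bar>Psi k p T y \<omega> $$ (i, j) - Gam M k p T y $$ (i, j)\<bar>
        \<le> (1 - q) * kappa_sq (Gam M k p T y) s / (16 * real s))"
proof -
  let ?f = "\<lambda>i j. \<bar>Psi k p T y \<omega> $$ (i, j) - Gam M k p T y $$ (i, j)\<bar>"
  have zero: "0 \<in> {..<k * p}" using kp_pos by (simp only: lessThan_iff)
  have e: "{?f i j |i j. i < k * p \<and> j < k * p} = (\<lambda>(i, j). ?f i j) ` ({..<k * p} \<times> {..<k * p})" by auto
  have "Max {?f i j |i j. i < k * p \<and> j < k * p} \<le> c \<longleftrightarrow> (\<forall>i<k * p. \<forall>j<k * p. ?f i j \<le> c)" for c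
    unfolding e
  proof (subst Max_le_iff)
    show "(\<lambda>(i, j). ?f i j) ` ({..<k * p} \<times> {..<k * p}) \<noteq> {}" using zero by blast
  qed auto
  then show ?thesis by (simp add: C_event_def)
qed

lemma Psi_measurable:
  assumes "i < k * p" "j < k * p"
  shows "(\<lambda>\<omega>. Psi k p T y \<omega> $$ (i, j)) \<in> borel_measurable M"
  unfolding Psi_index[OF assms]
  by (intro borel_measurable_divide borel_measurable_sum borel_measurable_times borel_measurable_const innovation_space_measurable[OF z_innovation_space])

text \<open>
  The chain \<open>\<kappa>\<^sup>2 \<le> \<Gamma>\<^sub>0\<^sub>0 \<le> \<parallel>\<Gamma>\<parallel> \<le> dependence_factor T\<close>, tested on the first unit vector.  It places the
  threshold of the event in the range where the tail of the quadratic form is Gaussian.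
\<close>

lemma kappa_sq_Gam_le_dependence_factor:
  assumes T: "1 \<le> T" and s: "0 < s"
  shows "kappa_sq (Gam M k p T y) s \<le> dependence_factor T"
proof -
  let ?u = "\<lambda>m. if m = 0 then 1 else 0 :: real"
  have u: "(\<Sum>m<k * p. (?u m)\<^sup>2) = 1" using kp_pos by (simp add: if_distrib[of "\<lambda>x. x\<^sup>2"] cong: if_cong)
  have "kappa_sq (Gam M k p T y) s * 1 \<le> quad (k * p) (Gam M k p T y) ?u"
    using kappa_sq_le_supported[OF psd_Gam[OF T], of "{0}" s ?u] kp_pos s unfolding u by simp
  also have "\<dots> \<le> \<bar>quad (k * p) (1\<^sub>m (k * p) * Gam M k p T y) ?u\<bar>"
    unfolding left_mult_one_mat[OF Gam_carrier] by simp
  also have "\<dots> \<le> spectral_norm (Gam M k p T y)"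
    using abs_quad_mult_le[OF one_carrier_mat Gam_carrier kp_pos, of T ?u] unfolding u spectral_norm_one[OF kp_pos] by simp
  also have "\<dots> \<le> dependence_factor T" by (rule spectral_norm_Gam_le_dependence_factor)
  finally show ?thesis by simp
qed

lemma prob_C_event_ge:
  assumes T: "1 \<le> T" and q: "0 < q" "q < 1" and s: "0 < s" and \<kappa>: "0 < kappa_sq (Gam M k p T y) s"
  shows "1 - 4 * (real (k * p))\<^sup>2 * exp (- (zeta M k p Phi T y q s * real T / (real s)\<^sup>2)) \<le> prob (C_event M k p T y q s)"
proof -
  let ?N = "k * p" and ?\<kappa> = "kappa_sq (Gam M k p T y) s"
  define a where "a = (1 - q) * ?\<kappa> / (16 * real s)"
  have a0: "0 < a" using q s \<kappa> by (simp add: a_def)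
  have \<kappa>G: "?\<kappa> \<le> dependence_factor T" by (rule kappa_sq_Gam_le_dependence_factor[OF T s])
  have G: "0 < dependence_factor T" using \<kappa> \<kappa>G by linarith
  have aG: "a \<le> dependence_factor T"
  proof -
    have "a \<le> ?\<kappa> / 1" unfolding a_def using q s \<kappa> by (intro frac_le) (auto simp: mult_le_cancel_right1)
    then show ?thesis using \<kappa>G by simp
  qed
  define B where "B i j = {\<omega> \<in> space M. a < \<bar>Psi k p T y \<omega> $$ (i, j) - Gam M k p T y $$ (i, j)\<bar>}" for i j
  have Bm: "B i j \<in> sets M" if "i < ?N" "j < ?N" for i j
    unfolding B_def using Psi_measurable[OF that, of T] by measurable
  define U where "U = (\<Union>(i, j)\<in>{..<?N} \<times> {..<?N}. B i j)"
  have Um: "U \<in> sets M" unfolding U_def by (intro sets.finite_UN) (auto intro: Bm)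
  have C: "C_event M k p T y q s = space M - U"
    unfolding U_def B_def by (auto simp: C_event_iff a_def[symmetric] not_less) (meson leD)
  have "prob U \<le> (\<Sum>x\<in>{..<?N} \<times> {..<?N}. prob (case x of (i, j) \<Rightarrow> B i j))"
    unfolding U_def by (rule measure_UNION_le) (auto intro: Bm)
  also have "\<dots> \<le> (\<Sum>x\<in>{..<?N} \<times> {..<?N}. 4 * exp (- (real T * a\<^sup>2 / (64 * (dependence_factor T)\<^sup>2))))"
    by (rule sum_mono) (auto simp: B_def intro!: entry_deviation[OF T _ _ G a0 aG])
  also have "\<dots> = 4 * (real ?N)\<^sup>2 * exp (- (real T * a\<^sup>2 / (64 * (dependence_factor T)\<^sup>2)))"
    by (simp add: power2_eq_square)
  also have "real T * a\<^sup>2 / (64 * (dependence_factor T)\<^sup>2) = zeta M k p Phi T y q s * real T / (real s)\<^sup>2"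
    unfolding zeta_def a_def dependence_factor_def[symmetric] by (simp add: power_mult_distrib power_divide mult_ac)
  finally show ?thesis unfolding C prob_compl[OF Um] by simp
qed

end

text \<open>
  Both factors increase, and \<open>ln 2 * (2 * ln 2 + 1) \<ge> 2/3 * 7/3\<close>.
\<close>

lemma log_factor_ge_one:
  assumes T: "2 \<le> T" and N: "2 \<le> N"
  shows "1 \<le> ln (real T) * (ln ((real N)\<^sup>2) + 1)"
proof -
  have "2/3 \<le> ln (real T)"
    using ln2_ge_two_thirds ln_le_cancel_iff[of 2 "real T"] T by linarith
  moreover have "2/3 \<le> ln (real N)"
    using ln2_ge_two_thirds ln_le_cancel_iff[of 2 "real N"] N by linarith
  then have "7/3 \<le> ln ((real N)\<^sup>2) + 1" using N by (simp add: ln_realpow)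
  ultimately have "2/3 * (7/3) \<le> ln (real T) * (ln ((real N)\<^sup>2) + 1)" by (intro mult_mono) auto
  then show ?thesis by linarith
qed

theorem lemma9:
  fixes M :: "'w measure"
    and k p T s :: nat
    and Phi :: "nat \<Rightarrow> real mat"
    and Sig :: "real mat"
    and eps y :: "int \<Rightarrow> 'w \<Rightarrow> real vec"
    and q :: real
  assumes "stationary_gaussian_var M k p Phi Sig eps y"
    and "1 \<le> T"
    and "0 < q" and "q < 1"
    and "s \<in> {1..k * p}"
  shows "(\<forall>\<omega> \<in> C_event M k p T y q s.
            kappa_sq (Psi k p T y \<omega>) s \<ge> q * kappa_sq (Gam M k p T y) s \<and>
            (\<forall>J. J \<subseteq> {..<k * p} \<and> card J = s \<longrightarrow>
               phi_min (submatrix (Psi k p T y \<omega>) J J)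
                 \<ge> q * phi_min (submatrix (Gam M k p T y) J J))) \<and>
         measure M (C_event M k p T y q s)
           \<ge> 1 - 4 * (real k)\<^sup>2 * (real p)\<^sup>2 *
                   exp (- (zeta M k p Phi T y q s) * real T /
                        ((real s)\<^sup>2 * ln (real T) * (ln ((real k)\<^sup>2 * (real p)\<^sup>2) + 1)))
               - 2 * ((real k)\<^sup>2 * (real p)\<^sup>2) powr (1 - ln (real T))"
proof -
  interpret stationary_gaussian_var M k p Phi Sig eps y by (rule assms(1))
  let ?N = "k * p" and ?\<kappa> = "kappa_sq (Gam M k p T y) s" and ?\<zeta> = "zeta M k p Phi T y q s"
  have s: "0 < s" using assms(5) by simp
  note psd = psd_Gam[OF assms(2)]
  have N2: "(real k)\<^sup>2 * (real p)\<^sup>2 = (real ?N)\<^sup>2" by (simp add: power_mult_distrib)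
  have "1 \<le> real ?N" using kp_pos by linarith
  then have N1: "1 \<le> (real ?N)\<^sup>2" by (rule one_le_power)
  have det: "kappa_sq (Psi k p T y \<omega>) s \<ge> q * ?\<kappa> \<and>
            (\<forall>J. J \<subseteq> {..<k * p} \<and> card J = s \<longrightarrow>
               phi_min (submatrix (Psi k p T y \<omega>) J J) \<ge> q * phi_min (submatrix (Gam M k p T y) J J))"
    if "\<omega> \<in> C_event M k p T y q s" for \<omega>
  proof -
    define m where "m = (1 - q) * ?\<kappa> / (16 * real s)"
    have m: "\<bar>Psi k p T y \<omega> $$ (i, j) - Gam M k p T y $$ (i, j)\<bar> \<le> m" if "i < ?N" "j < ?N" for i j
      using \<open>\<omega> \<in> C_event M k p T y q s\<close> that unfolding C_event_iff m_def by blast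
    have ms: "16 * m * real s \<le> (1 - q) * ?\<kappa>" using s by (simp add: m_def)
    show ?thesis
    proof (intro conjI allI impI)
      show "q * ?\<kappa> \<le> kappa_sq (Psi k p T y \<omega>) s"
        by (rule kappa_sq_perturb[OF Psi_carrier psd m kp_pos s ms])
      fix J assume "J \<subseteq> {..<k * p} \<and> card J = s"
      then show "q * phi_min (submatrix (Gam M k p T y) J J) \<le> phi_min (submatrix (Psi k p T y \<omega>) J J)"
        using assms(3,4) by (intro phi_min_submatrix_perturb[OF Psi_carrier Psi_sym psd m _ _ s _ _ ms]) auto
    qed
  qed
  define L where "L = ln (real T) * (ln ((real ?N)\<^sup>2) + 1)"
  define X where "X = exp (- ?\<zeta> * real T / ((real s)\<^sup>2 * L))"
  define Y where "Y = ((real ?N)\<^sup>2) powr (1 - ln (real T))"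
  have Y0: "0 \<le> Y" by (simp add: Y_def)
  have X0: "0 \<le> X" by (simp add: X_def)
  have main: "1 - 4 * (real ?N)\<^sup>2 * X - 2 * Y \<le> prob (C_event M k p T y q s)"
  proof -
    have trivial: ?thesis if "1 \<le> X \<or> 1 \<le> 2 * Y"
    proof -
      have "1 \<le> 4 * (real ?N)\<^sup>2 * X + 2 * Y"
      proof (cases "1 \<le> X")
        case True
        then have "1 * 1 \<le> (real ?N)\<^sup>2 * X" using N1 by (intro mult_mono) auto
        then show ?thesis using Y0 by linarith
      next
        case False
        then have "1 \<le> 2 * Y" using that by simp
        moreover have "0 \<le> 4 * (real ?N)\<^sup>2 * X" using X0 by simp
        ultimately show ?thesis by linarith
      qed
      then show ?thesis using measure_nonneg[of M "C_event M k p T y q s"] by linarith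
    qed
    \<comment> \<open>The claimed lower bound is not positive in three cases: for \<open>T = 1\<close>, where \<open>ln T = 0\<close> and
      the quotient by 0 is 0, and for \<open>\<kappa> = 0\<close>, where \<open>\<zeta> = 0\<close>, the exponential is 1; for \<open>kp = 1\<close>
      the last term is 2.\<close>
    consider "T = 1" | "?N = 1" | "?\<kappa> = 0" | "2 \<le> T" "2 \<le> ?N" "0 < ?\<kappa>"
      using assms(2) kp_pos kappa_sq_nonneg[OF psd kp_pos s] by linarith
    then show ?thesis
    proof cases
      case 1
      then show ?thesis by (intro trivial) (simp add: X_def L_def)
    next
      case 2
      then have "Y = 1" unfolding Y_def by (simp only:) simp
      then show ?thesis by (intro trivial) simp
    next
      case 3
      then show ?thesis by (intro trivial) (simp add: X_def zeta_def)
    next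
      case 4
      have L1: "1 \<le> L" unfolding L_def by (rule log_factor_ge_one[OF 4(1,2)])
      have \<zeta>0: "0 \<le> ?\<zeta>" by (simp add: zeta_def)
      have "?\<zeta> * real T / ((real s)\<^sup>2 * L) \<le> ?\<zeta> * real T / (real s)\<^sup>2"
        using L1 \<zeta>0 s by (intro divide_left_mono) auto
      then have "exp (- (?\<zeta> * real T / (real s)\<^sup>2)) \<le> X" by (simp add: X_def)
      then have "4 * (real ?N)\<^sup>2 * exp (- (?\<zeta> * real T / (real s)\<^sup>2)) \<le> 4 * (real ?N)\<^sup>2 * X"
        by (rule mult_left_mono) simp
      then show ?thesis
        using prob_C_event_ge[OF assms(2-4) s 4(3)] Y0 by linarith
    qed
  qed
  have e: "4 * (real k)\<^sup>2 * (real p)\<^sup>2 = 4 * (real ?N)\<^sup>2" using N2 by (simp only: mult.assoc)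
  show ?thesis
    using det main unfolding X_def Y_def L_def N2 e mult.assoc[of "(real s)\<^sup>2"] by blast
qed

end
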